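(* Let $f(r)=\mathrm dF(r)/\mathrm dr$, $c>0$ and $\alpha=4$. Then $$\mathbb{E}[\mathsf I(y_0)]=\lambda A_4(y_0,c)<\infty,$$ where $A_4(y_0,c)$ is given by $$A_4(y_0,c)=\frac{\pi}{2\sqrt c}\left(F(r)\arctan\frac{2\,\mathfrak R\{\kappa(r,c,y_0)\}}{1-|\kappa(r,c,y_0)|^2}\Big|_{r=0}^{\infty}-\int_0^\infty f(r)\arctan\frac{2\,\mathfrak R\{\kappa(r,c,y_0)\}}{1-|\kappa(r,c,y_0)|^2}\,\mathrm dr\right)$$ and $$\kappa(r,c,y_0)=\frac{r^2-\|y_0\|^2-j\sqrt c}{\sqrt{\big(\sqrt c+j(r^2+\|y_0\|^2)\big)^2+4r^2\|y_0\|^2}}.$$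
   Context: $\Phi$ is an isotropic Poisson point process on $\mathbb{R}^2$ with intensity function $\lambda(x)=\lambda F(\|x\|)$, where $0<\lambda<\infty$ is a constant and $F:[0,\infty)\to[0,1]$ is the shape function. The points $\mathsf x$ of $\Phi$ (interferers) carry i.i.d. power fading coefficients $\mathsf g_{\mathsf x}\ge0$ of arbitrary distribution, independent of $\Phi$, with $\mathbb{E}[\mathsf g_{\mathsf x}]=1$. The path loss function is $\ell(r)=(c+r^{\alpha})^{-1}$. The interference at the receiver location $y_0\in\mathbb{R}^2$ is $\mathsf I(y_0)=\sum_{\mathsf x\in\Phi}\mathsf g_{\mathsf x}\,\ell(\|\mathsf x-y_0\|)$. Here $j=\sqrt{-1}$ and $\mathfrak R$ denotes the real part.
   Formalization: At y0 = 0 the quotient in the arctan is 0/0 for every r, so its limit as y0 → 0 is used; the boundary values at r = 0 and ∞ are limits; the formula is asserted when F(r) has a limit as r → ∞ (otherwise the boundary term is undefined), finiteness always. *)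

theory Defs
  imports "HOL-Probability.Probability"
begin

text \<open>
  A point process is a random locally finite set of points; this suffices because the intensity
  measures considered below have a density. The Poisson law is written out (instead of using
  \<open>poisson_pmf\<close>, which requires a positive rate) to cover sets of intensity measure zero.
\<close>

definition point_count :: "('w \<Rightarrow> 'p set) \<Rightarrow> 'p set \<Rightarrow> 'w \<Rightarrow> nat" where
  "point_count \<Phi> B \<omega> = card (\<Phi> \<omega> \<inter> B)"

definition poisson_point_process ::
    "'w measure \<Rightarrow> ('p::euclidean_space) measure \<Rightarrow> ('w \<Rightarrow> 'p set) \<Rightarrow> bool" where
  "poisson_point_process M \<Lambda> \<Phi> \<longleftrightarrow>
     prob_space M \<and>
     (\<forall>\<omega>\<in>space M. \<forall>B. bounded B \<longrightarrow> finite (\<Phi> \<omega> \<inter> B)) \<and>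
     (\<forall>B\<in>sets borel. bounded B \<longrightarrow>
        point_count \<Phi> B \<in> measurable M (count_space UNIV) \<and>
        (\<forall>k. measure M {\<omega>\<in>space M. point_count \<Phi> B \<omega> = k} =
               measure \<Lambda> B ^ k / fact k * exp (- measure \<Lambda> B))) \<and>
     (\<forall>(I :: nat set) B. finite I \<longrightarrow> (\<forall>i\<in>I. B i \<in> sets borel \<and> bounded (B i)) \<longrightarrow>
        disjoint_family_on B I \<longrightarrow>
        prob_space.indep_vars M (\<lambda>_. count_space UNIV) (\<lambda>i. point_count \<Phi> (B i)) I)"

definition isotropic_intensity :: "real \<Rightarrow> (real \<Rightarrow> real) \<Rightarrow> (real^2) measure" where
  "isotropic_intensity lam F = density lborel (\<lambda>x. ennreal (lam * F (norm x)))"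

text \<open>
  A family of independent random variables indexed by all points of the plane could not be
  evaluated measurably at the random points of \<open>\<Phi>\<close>. The points are therefore enumerated
  measurably and without repetition as \<open>X 0, X 1, \<dots>\<close>; the number \<open>N\<close> of points may be
  infinite, and \<open>g i\<close> is the fading coefficient of the point \<open>X i\<close>. The values \<open>X i \<omega>\<close>
  with \<open>i \<ge> N \<omega>\<close> do not enter the interference. Independence of the fading from \<open>\<Phi>\<close> is
  independence of the whole sequence \<open>g\<close> from the enumerated process \<open>(N, X)\<close>; two
  \<open>\<sigma>\<close>-algebras are used because \<open>indep_var\<close> needs variables of the same type.
\<close>

definition iid_fading ::
    "'w measure \<Rightarrow> ('w \<Rightarrow> (real^2) set) \<Rightarrow> ('w \<Rightarrow> enat) \<Rightarrow> (nat \<Rightarrow> 'w \<Rightarrow> real^2) \<Rightarrow>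
     (nat \<Rightarrow> 'w \<Rightarrow> real) \<Rightarrow> bool" where
  "iid_fading M \<Phi> N X g \<longleftrightarrow>
     N \<in> measurable M (count_space UNIV) \<and>
     (\<forall>i. X i \<in> borel_measurable M) \<and>
     (\<forall>\<omega>\<in>space M. bij_betw (\<lambda>i. X i \<omega>) {i. enat i < N \<omega>} (\<Phi> \<omega>)) \<and>
     (\<forall>i. g i \<in> borel_measurable M) \<and>
     (\<forall>i. \<forall>\<omega>\<in>space M. 0 \<le> g i \<omega>) \<and>
     (\<forall>i. distr M borel (g i) = distr M borel (g 0)) \<and>
     prob_space.indep_vars M (\<lambda>_. borel) g UNIV \<and>
     prob_space.indep_set M
       (sets (vimage_algebra (space M) (\<lambda>\<omega> i. g i \<omega>) (\<Pi>\<^sub>M i\<in>UNIV. borel)))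
       (sets (vimage_algebra (space M) (\<lambda>\<omega>. (N \<omega>, \<lambda>i. X i \<omega>))
                (count_space UNIV \<Otimes>\<^sub>M (\<Pi>\<^sub>M i\<in>UNIV. borel)))) \<and>
     (\<forall>i. prob_space.expectation M (g i) = 1)"

definition path_loss :: "real \<Rightarrow> real \<Rightarrow> real \<Rightarrow> real" where
  "path_loss c \<alpha> r = inverse (c + r powr \<alpha>)"

definition interference ::
    "real \<Rightarrow> real \<Rightarrow> ('w \<Rightarrow> enat) \<Rightarrow> (nat \<Rightarrow> 'w \<Rightarrow> real^2) \<Rightarrow> (nat \<Rightarrow> 'w \<Rightarrow> real) \<Rightarrow>
     real^2 \<Rightarrow> 'w \<Rightarrow> ennreal" where
  "interference c \<alpha> N X g y0 \<omega> =
     (\<Sum>\<^sub>\<infinity>i\<in>{i. enat i < N \<omega>}. ennreal (g i \<omega> * path_loss c \<alpha> (norm (X i \<omega> - y0))))"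

definition kappa :: "real \<Rightarrow> real \<Rightarrow> real^2 \<Rightarrow> complex" where
  "kappa r c y =
     (of_real (r\<^sup>2 - (norm y)\<^sup>2) - \<i> * of_real (sqrt c)) /
     csqrt ((of_real (sqrt c) + \<i> * of_real (r\<^sup>2 + (norm y)\<^sup>2))\<^sup>2 +
            of_real (4 * r\<^sup>2 * (norm y)\<^sup>2))"

definition arctan_quotient :: "real \<Rightarrow> real \<Rightarrow> real^2 \<Rightarrow> real" where
  "arctan_quotient r c y = arctan (2 * Re (kappa r c y) / (1 - (cmod (kappa r c y))\<^sup>2))"

text \<open>
  For \<open>y = 0\<close> one has \<open>kappa r c y = - \<i>\<close> for all \<open>r\<close>, so that the quotient is
  \<open>0 / 0\<close>; there the term is understood as its continuous extension in \<open>y\<close>.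
\<close>

definition arctan_term :: "real \<Rightarrow> real \<Rightarrow> real^2 \<Rightarrow> real" where
  "arctan_term r c y0 =
     (if y0 = 0 then Lim (at 0) (\<lambda>y. arctan_quotient r c y) else arctan_quotient r c y0)"

text \<open>
  The quotient is also undefined at \<open>r = 0\<close>, where \<open>cmod (kappa 0 c y) = 1\<close>, so both ends of the
  boundary term are one-sided limits. The integral is the Henstock--Kurzweil integral, which agrees
  with the Lebesgue integral and with the improper Riemann integral whenever these exist.
\<close>

definition A4 :: "(real \<Rightarrow> real) \<Rightarrow> (real \<Rightarrow> real) \<Rightarrow> real^2 \<Rightarrow> real \<Rightarrow> real" where
  "A4 F f y0 c =
     pi / (2 * sqrt c) *
       ((Lim at_top (\<lambda>r. F r * arctan_term r c y0) -
         Lim (at_right 0) (\<lambda>r. F r * arctan_term r c y0)) -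
        integral {0..} (\<lambda>r. f r * arctan_term r c y0))"

end

theory Submission
  imports Defs
begin

text \<open>
  By Campbell's formula and the unit mean of the fading the expected interference is
  \<open>\<integral> \<lambda>(x) \<ell>(\<parallel>x - y0\<parallel>) dx\<close>. Put \<open>s = sqrt c\<close>, \<open>d = \<parallel>y0\<parallel>\<close>, \<open>A = s + \<i> (r\<^sup>2 + d\<^sup>2)\<close>, \<open>v = s + \<i> (r\<^sup>2 - d\<^sup>2)\<close> and let
  \<open>w\<close> be the principal square root of \<open>A\<^sup>2 + 4 r\<^sup>2 d\<^sup>2 = v\<^sup>2 + 4 \<i> s d\<^sup>2\<close>, the denominator of \<open>\<kappa>\<close> (\<open>ksqrt\<close> below). In
  polar coordinates the integral of the path loss over the circle of radius \<open>r\<close> is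
  \<open>(2 \<pi> / s) r Re (1 / w)\<close>, since \<open>1 / (c + \<rho>\<^sup>2) = Re (1 / (s + \<i> \<rho>)) / s\<close>. On the other hand \<open>\<kappa> = - \<i> v / w\<close>,
  so that the arctangent in \<open>A4\<close> is the argument of \<open>(w + v) / (w - v)\<close>, which is a positive multiple of
  \<open>- \<i> (w + v)\<^sup>2\<close> (\<open>phase\<close> below). As \<open>w' = v v' / w\<close>, its \<open>r\<close>-derivative is \<open>Im (2 v' / w) = 4 r Re (1 / w)\<close>, and
  integration by parts against \<open>F\<close> gives the formula. The argument of \<open>- \<i> (w + v)\<^sup>2\<close> is also
  defined for \<open>r = 0\<close> and for \<open>d = 0\<close>, where the quotient in \<open>A4\<close> degenerates.
\<close>

subsection \<open>Campbell's formula\<close>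

text \<open>Summing over the values of \<open>C\<close>, the summand for \<open>k = 0\<close>
  vanishes, and after shifting the index by one the rest is \<open>m * exp (- m)\<close> times the
  exponential series. The case \<open>m = 0\<close> is included.\<close>

lemma nn_integral_poisson_count:
  fixes C :: "'w \<Rightarrow> nat"
  assumes "prob_space M" and [measurable]: "C \<in> measurable M (count_space UNIV)" and "0 \<le> m"
    and pmf: "\<And>k. measure M {\<omega>\<in>space M. C \<omega> = k} = m ^ k / fact k * exp (- m)"
  shows "(\<integral>\<^sup>+\<omega>. of_nat (C \<omega>) \<partial>M) = ennreal m"
proof -
  interpret prob_space M by fact
  have "(\<integral>\<^sup>+\<omega>. of_nat (C \<omega>) \<partial>M) = (\<integral>\<^sup>+\<omega>. (\<Sum>k. of_nat k * indicator {\<omega>\<in>space M. C \<omega> = k} \<omega>) \<partial>M)"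
  proof (intro nn_integral_cong)
    fix \<omega> assume "\<omega> \<in> space M"
    then have "(\<Sum>k. of_nat k * indicator {\<omega>\<in>space M. C \<omega> = k} \<omega> :: ennreal) =
        (\<Sum>k\<in>{C \<omega>}. of_nat k * indicator {\<omega>\<in>space M. C \<omega> = k} \<omega>)"
      by (intro suminf_finite) auto
    then show "of_nat (C \<omega>) = (\<Sum>k. of_nat k * indicator {\<omega>\<in>space M. C \<omega> = k} \<omega> :: ennreal)"
      using \<open>\<omega> \<in> space M\<close> by simp
  qed
  also have "\<dots> = (\<Sum>k. of_nat k * emeasure M {\<omega>\<in>space M. C \<omega> = k})"
    by (subst nn_integral_suminf) (auto simp: nn_integral_cmult intro!: suminf_cong)
  also have "\<dots> = (\<Sum>k. ennreal (real k * (m ^ k / fact k * exp (- m))))"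
    by (intro suminf_cong)
       (simp add: emeasure_eq_measure pmf ennreal_of_nat_eq_real_of_nat flip: ennreal_mult')
  also have "\<dots> = ennreal m"
  proof (rule suminf_ennreal_eq)
    have "(\<lambda>k. m * exp (- m) * (m ^ k /\<^sub>R fact k)) sums (m * exp (- m) * exp m)"
      by (intro sums_mult exp_converges)
    moreover have "m * exp (- m) * (m ^ k /\<^sub>R fact k) = real (Suc k) * (m ^ Suc k / fact (Suc k) * exp (- m))" for k
      by (simp add: field_simps del: of_nat_Suc)
    moreover have "m * exp (- m) * exp m = m" by (simp add: exp_minus)
    ultimately have "(\<lambda>k. real (Suc k) * (m ^ Suc k / fact (Suc k) * exp (- m))) sums m"
      by (simp only:)
    then show "(\<lambda>k. real k * (m ^ k / fact k * exp (- m))) sums m"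
      by (subst (asm) sums_Suc_iff) simp
  qed (use assms(3) in auto)
  finally show ?thesis .
qed

text \<open>Both sides are integrals of \<open>h\<close>: the left one against the intensity measure
  of the enumerated points, the right one against \<Lambda>. The Poisson mean identifies the two
  measures on bounded Borel sets, and every Borel set is an increasing union of bounded
  ones.\<close>

lemma campbell_enumerated:
  fixes \<Lambda> :: "('p::euclidean_space) measure" and h :: "'p \<Rightarrow> ennreal"
  assumes ppp: "poisson_point_process M \<Lambda> \<Phi>" and sets[measurable_cong]: "sets \<Lambda> = sets borel"
    and fin: "\<And>B. B \<in> sets borel \<Longrightarrow> bounded B \<Longrightarrow> emeasure \<Lambda> B < \<infinity>"
    and N[measurable]: "N \<in> measurable M (count_space UNIV)"
    and X[measurable]: "\<And>i. X i \<in> borel_measurable M"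
    and enum: "\<And>\<omega>. \<omega> \<in> space M \<Longrightarrow> bij_betw (\<lambda>i. X i \<omega>) {i. enat i < N \<omega>} (\<Phi> \<omega>)"
    and h[measurable]: "h \<in> borel_measurable borel"
  shows "(\<Sum>i. \<integral>\<^sup>+\<omega>. indicator {\<omega>. enat i < N \<omega>} \<omega> * h (X i \<omega>) \<partial>M) = (\<integral>\<^sup>+x. h x \<partial>\<Lambda>)"
proof -
  interpret prob_space M using ppp by (simp add: poisson_point_process_def)
  let ?P = "count_space (UNIV :: nat set) \<Otimes>\<^sub>M M"
  define I where "I i \<omega> = (indicator {\<omega>. enat i < N \<omega>} \<omega> :: ennreal)" for i \<omega>
  have I[measurable]: "(\<lambda>(i, \<omega>). I i \<omega>) \<in> borel_measurable ?P"
    unfolding I_def by (intro measurable_pair_measure_countable1) auto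
  have X'[measurable]: "(\<lambda>(i, \<omega>). X i \<omega>) \<in> measurable ?P borel"
    by (intro measurable_pair_measure_countable1) auto
  \<comment> \<open>The measure of \<open>B\<close> is the expected number of pairs of an index
    \<open>i < N\<close> and an outcome with \<open>X i\<close> in \<open>B\<close>. Writing it as
    an image measure makes its countable additivity automatic.\<close>
  define \<nu> where "\<nu> = distr (density ?P (\<lambda>(i, \<omega>). I i \<omega>)) borel (\<lambda>(i, \<omega>). X i \<omega>)"
  have int: "(\<integral>\<^sup>+x. u x \<partial>\<nu>) = (\<Sum>i. \<integral>\<^sup>+\<omega>. I i \<omega> * u (X i \<omega>) \<partial>M)"
    if [measurable]: "u \<in> borel_measurable borel" for u :: "'p \<Rightarrow> ennreal"
  proof -
    have "(\<integral>\<^sup>+x. u x \<partial>\<nu>) = (\<integral>\<^sup>+z. (case z of (i, \<omega>) \<Rightarrow> I i \<omega> * u (X i \<omega>)) \<partial>?P)"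
      unfolding \<nu>_def by (simp add: nn_integral_distr nn_integral_density split_beta')
    also have "\<dots> = (\<integral>\<^sup>+i. \<integral>\<^sup>+\<omega>. I i \<omega> * u (X i \<omega>) \<partial>M \<partial>count_space UNIV)"
      by (subst nn_integral_fst[symmetric]) (auto simp: split_beta')
    finally show ?thesis by (simp add: nn_integral_count_space_nat)
  qed
  have bounded_eq: "emeasure \<nu> B = emeasure \<Lambda> B" if B[measurable]: "B \<in> sets borel" and "bounded B" for B
  proof -
    have "emeasure \<nu> B = (\<integral>\<^sup>+x. indicator B x \<partial>\<nu>)" by (simp add: \<nu>_def)
    also have "\<dots> = (\<integral>\<^sup>+\<omega>. (\<Sum>i. I i \<omega> * indicator B (X i \<omega>)) \<partial>M)"
      by (simp add: int nn_integral_suminf I_def)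
    also have "\<dots> = (\<integral>\<^sup>+\<omega>. of_nat (point_count \<Phi> B \<omega>) \<partial>M)"
    proof (intro nn_integral_cong)
      fix \<omega> assume \<omega>: "\<omega> \<in> space M"
      let ?J = "{i. enat i < N \<omega> \<and> X i \<omega> \<in> B}"
      \<comment> \<open>As the enumeration has no repetitions, counting indices is the same as
        counting points.\<close>
      have bij: "bij_betw (\<lambda>i. X i \<omega>) ?J (\<Phi> \<omega> \<inter> B)"
        using enum[OF \<omega>] by (auto simp: bij_betw_def inj_on_def)
      have "finite (\<Phi> \<omega> \<inter> B)" using ppp \<omega> \<open>bounded B\<close> by (simp add: poisson_point_process_def)
      then have "finite ?J" using bij bij_betw_finite by blast
      have "(\<Sum>i. I i \<omega> * indicator B (X i \<omega>)) = (\<Sum>i\<in>?J. I i \<omega> * indicator B (X i \<omega>))"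
        by (intro suminf_finite \<open>finite ?J\<close>) (auto simp: I_def)
      also have "\<dots> = of_nat (card ?J)" by (simp add: I_def)
      finally show "(\<Sum>i. I i \<omega> * indicator B (X i \<omega>)) = of_nat (point_count \<Phi> B \<omega>)"
        by (simp add: point_count_def bij_betw_same_card[OF bij])
    qed
    also have "\<dots> = ennreal (measure \<Lambda> B)"
      using ppp B \<open>bounded B\<close> unfolding poisson_point_process_def
      by (intro nn_integral_poisson_count) auto
    also have "\<dots> = emeasure \<Lambda> B" using fin[OF B \<open>bounded B\<close>] by (intro emeasure_eq_ennreal_measure[symmetric]) auto
    finally show ?thesis .
  qed
  have "\<nu> = \<Lambda>"
  proof (rule measure_eqI)
    have sets_\<nu>: "sets \<nu> = sets borel" by (simp add: \<nu>_def)
    then show "sets \<nu> = sets \<Lambda>" by (simp add: sets)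
    fix A assume "A \<in> sets \<nu>"
    then have A: "A \<in> sets borel" by (simp add: sets_\<nu>)
    let ?A = "\<lambda>n::nat. A \<inter> cball 0 (real n)"
    have UN: "(\<Union>n. ?A n) = A"
      by (auto simp: real_arch_simple)
    have inc: "incseq ?A" by (auto simp: incseq_def)
    have b: "?A n \<in> sets borel" "bounded (?A n)" for n using A by (auto intro: bounded_Int)
    have "emeasure \<nu> A = (SUP n. emeasure \<nu> (?A n))"
      using b inc by (subst SUP_emeasure_incseq) (auto simp: UN sets_\<nu> simp del: UN_simps)
    also have "\<dots> = (SUP n. emeasure \<Lambda> (?A n))" by (simp only: bounded_eq[OF b])
    also have "\<dots> = emeasure \<Lambda> A"
      using b inc by (subst SUP_emeasure_incseq) (auto simp: UN sets simp del: UN_simps)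
    finally show "emeasure \<nu> A = emeasure \<Lambda> A" .
  qed
  then show ?thesis using int[OF h] by (simp add: I_def)
qed

text \<open>Each summand is \<open>g i\<close> times a function of \<open>(N, X)\<close>.
  Independence and the unit mean remove \<open>g i\<close> from the expectation term by term, and
  Campbell's formula applies to what remains.\<close>

lemma nn_integral_interference:
  assumes ppp: "poisson_point_process M \<Lambda> \<Phi>" and sets: "sets \<Lambda> = sets borel"
    and fin: "\<And>B. B \<in> sets borel \<Longrightarrow> bounded B \<Longrightarrow> emeasure \<Lambda> B < \<infinity>"
    and fading: "iid_fading M \<Phi> N X g" and c: "0 < c"
  shows "(\<integral>\<^sup>+\<omega>. interference c \<alpha> N X g y0 \<omega> \<partial>M) = (\<integral>\<^sup>+x. ennreal (path_loss c \<alpha> (norm (x - y0))) \<partial>\<Lambda>)"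
proof -
  interpret prob_space M using ppp by (simp add: poisson_point_process_def)
  have N[measurable]: "N \<in> measurable M (count_space UNIV)" and X[measurable]: "\<And>i. X i \<in> borel_measurable M"
    and g[measurable]: "\<And>i. g i \<in> borel_measurable M"
    and g0: "\<And>i \<omega>. \<omega> \<in> space M \<Longrightarrow> 0 \<le> g i \<omega>" and g1: "\<And>i. expectation (g i) = 1"
    and enum: "\<And>\<omega>. \<omega> \<in> space M \<Longrightarrow> bij_betw (\<lambda>i. X i \<omega>) {i. enat i < N \<omega>} (\<Phi> \<omega>)"
    using fading by (auto simp: iid_fading_def)
  let ?l = "\<lambda>x. path_loss c \<alpha> (norm (x - y0))"
  have l[measurable]: "?l \<in> borel_measurable borel" unfolding path_loss_def by measurable
  have l0: "0 \<le> ?l x" and l1: "?l x \<le> 1 / c" for x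
    using c by (simp_all add: path_loss_def divide_simps add_pos_nonneg)
  \<comment> \<open>Extending by zero beyond \<open>N\<close> turns the sum with a random number of
    terms into a series over all indices. The bound \<open>1 / c\<close> gives integrability, which
    the product rule for independent variables requires.\<close>
  define Y where "Y i \<omega> = (if enat i < N \<omega> then ?l (X i \<omega>) else 0)" for i \<omega>
  have Y[measurable]: "Y i \<in> borel_measurable M" for i unfolding Y_def by measurable
  have Y0: "0 \<le> Y i \<omega>" and Y1: "Y i \<omega> \<le> 1 / c" for i \<omega> using l0 l1 c by (simp_all add: Y_def)
  have intY: "integrable M (Y i)" for i
    by (rule integrable_const_bound[of _ "1 / c"]) (use Y0 Y1 in auto)
  have intg: "integrable M (g i)" for i
    using g1[of i] not_integrable_integral_eq by fastforce
  \<comment> \<open>The hypothesis concerns the sigma-algebras generated by the whole sequence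
    \<open>g\<close> and by \<open>(N, X)\<close>. Those generated by \<open>g i\<close> and
    \<open>Y i\<close> are contained in them and so inherit independence.\<close>
  have indep: "indep_var borel (g i) borel (Y i)" for i
  proof -
    let ?G = "vimage_algebra (space M) (\<lambda>\<omega> i. g i \<omega>) (\<Pi>\<^sub>M i\<in>UNIV. borel :: real measure)"
    let ?Q = "count_space (UNIV :: enat set) \<Otimes>\<^sub>M (\<Pi>\<^sub>M i\<in>(UNIV :: nat set). borel :: (real^2) measure)"
    let ?H = "vimage_algebra (space M) (\<lambda>\<omega>. (N \<omega>, \<lambda>i. X i \<omega>)) ?Q"
    have "(\<lambda>\<omega> i. g i \<omega>) \<in> measurable ?G (\<Pi>\<^sub>M i\<in>UNIV. borel)"
      by (rule measurable_vimage_algebra1) (auto simp: space_PiM)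
    then have gG: "g i \<in> measurable ?G borel"
      by (rule measurable_compose[OF _ measurable_component_singleton[of i]]) simp
    have NX: "(\<lambda>\<omega>. (N \<omega>, \<lambda>i. X i \<omega>)) \<in> measurable ?H ?Q"
      by (rule measurable_vimage_algebra1) (auto simp: space_PiM space_pair_measure)
    have "(\<lambda>p. if enat i < fst p then ?l (snd p i) else 0) \<in> borel_measurable ?Q"
      by measurable
    from measurable_compose[OF NX this] have YH: "Y i \<in> measurable ?H borel"
      by (simp add: Y_def[abs_def] cong: if_cong)
    have ind: "indep_set (sets ?G) (sets ?H)" using fading by (simp add: iid_fading_def)
    have sub1: "sigma_sets (space M) {g i -` A \<inter> space M |A. A \<in> sets borel} \<subseteq> sets ?G"
    proof -
      have "sigma_sets (space ?G) {g i -` A \<inter> space M |A. A \<in> sets borel} \<subseteq> sets ?G"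
        by (rule sets.sigma_sets_subset) (use measurable_sets[OF gG] in \<open>auto simp only: space_vimage_algebra\<close>)
      then show ?thesis by (simp only: space_vimage_algebra)
    qed
    have sub2: "sigma_sets (space M) {Y i -` A \<inter> space M |A. A \<in> sets borel} \<subseteq> sets ?H"
    proof -
      have "sigma_sets (space ?H) {Y i -` A \<inter> space M |A. A \<in> sets borel} \<subseteq> sets ?H"
        by (rule sets.sigma_sets_subset) (use measurable_sets[OF YH] in \<open>auto simp only: space_vimage_algebra\<close>)
      then show ?thesis by (simp only: space_vimage_algebra)
    qed
    show ?thesis
      unfolding indep_var_eq
    proof (intro conjI indep_setI)
      fix a b assume "a \<in> sigma_sets (space M) {g i -` A \<inter> space M |A. A \<in> sets borel}"
        "b \<in> sigma_sets (space M) {Y i -` A \<inter> space M |A. A \<in> sets borel}"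
      then show "prob (a \<inter> b) = prob a * prob b"
        using indep_setD[OF ind] sub1 sub2 by blast
    qed (use sub1 sub2 indep_setD_ev1[OF ind] indep_setD_ev2[OF ind] in auto)
  qed
  have term_eq: "(\<integral>\<^sup>+\<omega>. ennreal (g i \<omega> * Y i \<omega>) \<partial>M) = (\<integral>\<^sup>+\<omega>. ennreal (Y i \<omega>) \<partial>M)" for i
  proof -
    have "(\<integral>\<^sup>+\<omega>. ennreal (g i \<omega> * Y i \<omega>) \<partial>M) = ennreal (expectation (\<lambda>\<omega>. g i \<omega> * Y i \<omega>))"
      using g0 Y0 by (intro nn_integral_eq_integral indep_var_integrable indep intg intY) auto
    also have "expectation (\<lambda>\<omega>. g i \<omega> * Y i \<omega>) = expectation (Y i)"
      by (simp add: indep_var_lebesgue_integral[OF indep intg intY] g1)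
    also have "ennreal (expectation (Y i)) = (\<integral>\<^sup>+\<omega>. ennreal (Y i \<omega>) \<partial>M)"
      using Y0 by (intro nn_integral_eq_integral[symmetric] intY) auto
    finally show ?thesis .
  qed
  have "(\<integral>\<^sup>+\<omega>. interference c \<alpha> N X g y0 \<omega> \<partial>M) = (\<integral>\<^sup>+\<omega>. (\<Sum>i. ennreal (g i \<omega> * Y i \<omega>)) \<partial>M)"
  proof (intro nn_integral_cong)
    fix \<omega>
    have "interference c \<alpha> N X g y0 \<omega> = infsum (\<lambda>i. ennreal (g i \<omega> * Y i \<omega>)) UNIV"
      unfolding interference_def by (intro infsum_cong_neutral) (auto simp: Y_def)
    also have "\<dots> = (\<Sum>i. ennreal (g i \<omega> * Y i \<omega>))"
      by (intro sums_unique has_sum_imp_sums has_sum_infsum nonneg_summable_on_complete) simp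
    finally show "interference c \<alpha> N X g y0 \<omega> = (\<Sum>i. ennreal (g i \<omega> * Y i \<omega>))" .
  qed
  also have "\<dots> = (\<Sum>i. \<integral>\<^sup>+\<omega>. ennreal (Y i \<omega>) \<partial>M)"
    by (simp add: nn_integral_suminf term_eq)
  also have "\<dots> = (\<Sum>i. \<integral>\<^sup>+\<omega>. indicator {\<omega>. enat i < N \<omega>} \<omega> * ennreal (?l (X i \<omega>)) \<partial>M)"
    by (intro suminf_cong nn_integral_cong) (simp add: Y_def indicator_def)
  also have "\<dots> = (\<integral>\<^sup>+x. ennreal (?l x) \<partial>\<Lambda>)"
    by (intro campbell_enumerated[OF ppp sets fin N X enum]) auto
  finally show ?thesis .
qed

subsection \<open>Polar coordinates\<close>

lemma nn_integral_lborel_fold: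
  fixes f :: "real \<Rightarrow> ennreal"
  assumes [measurable]: "f \<in> borel_measurable borel"
  shows "(\<integral>\<^sup>+x. f x \<partial>lborel) = (\<integral>\<^sup>+x. (f x + f (- x)) * indicator {0..} x \<partial>lborel)"
proof -
  have "(\<integral>\<^sup>+x. f x * indicator {..<0} x \<partial>lborel) = (\<integral>\<^sup>+x. f (- x) * indicator {..<0} (- x) \<partial>lborel)"
    by (subst nn_integral_real_affine[where c = "-1" and t = 0]) simp_all
  also have "\<dots> = (\<integral>\<^sup>+x. f (- x) * indicator {0..} x \<partial>lborel)"
    using AE_lborel_singleton[of "0::real"]
    by (intro nn_integral_cong_AE, eventually_elim) (auto simp: indicator_def)
  finally have neg: "(\<integral>\<^sup>+x. f x * indicator {..<0} x \<partial>lborel) = (\<integral>\<^sup>+x. f (- x) * indicator {0..} x \<partial>lborel)" .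
  have "(\<integral>\<^sup>+x. f x \<partial>lborel) = (\<integral>\<^sup>+x. f x * indicator {0..} x + f x * indicator {..<0} x \<partial>lborel)"
    by (intro nn_integral_cong) (auto simp: indicator_def)
  also have "\<dots> = (\<integral>\<^sup>+x. f x * indicator {0..} x \<partial>lborel) + (\<integral>\<^sup>+x. f (- x) * indicator {0..} x \<partial>lborel)"
    by (subst nn_integral_add) (simp_all add: neg)
  also have "\<dots> = (\<integral>\<^sup>+x. (f x + f (- x)) * indicator {0..} x \<partial>lborel)"
    by (subst nn_integral_add[symmetric]) (simp_all add: distrib_right)
  finally show ?thesis .
qed

text \<open>
  The parameter \<open>t\<close> is the tangent of the polar angle: substituting first \<open>y = x * t\<close> and then
  \<open>x = r / sqrt (1 + t\<^sup>2)\<close> needs only one-dimensional affine substitutions and Tonelli's theorem.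
\<close>

lemma nn_integral_polar:
  fixes k :: "real \<times> real \<Rightarrow> ennreal"
  assumes [measurable]: "k \<in> borel_measurable borel"
  shows "(\<integral>\<^sup>+x. \<integral>\<^sup>+y. k (x, y) \<partial>lborel \<partial>lborel) =
    (\<integral>\<^sup>+r. ennreal r * indicator {0..} r *
       (\<integral>\<^sup>+t. ennreal (1 / (1 + t\<^sup>2)) *
          (k (r / sqrt (1 + t\<^sup>2), r * t / sqrt (1 + t\<^sup>2)) +
           k (- r / sqrt (1 + t\<^sup>2), - r * t / sqrt (1 + t\<^sup>2))) \<partial>lborel) \<partial>lborel)"
proof -
  have [measurable]: "k \<in> borel_measurable (borel \<Otimes>\<^sub>M borel)" by (simp add: borel_prod)
  let ?q = "\<lambda>t::real. sqrt (1 + t\<^sup>2)"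
  have q: "0 < ?q t" for t by (simp add: add_pos_nonneg)
  have "(\<integral>\<^sup>+x. \<integral>\<^sup>+y. k (x, y) \<partial>lborel \<partial>lborel) = (\<integral>\<^sup>+x. \<integral>\<^sup>+t. ennreal \<bar>x\<bar> * k (x, x * t) \<partial>lborel \<partial>lborel)"
  \<comment> \<open>The substitution \<open>y = x * t\<close> degenerates at \<open>x = 0\<close>, a
    null set.\<close>
  proof (intro nn_integral_cong_AE, use AE_lborel_singleton[of "0::real"] in eventually_elim)
    fix x :: real assume "x \<noteq> 0"
    then have "(\<integral>\<^sup>+y. k (x, y) \<partial>lborel) = ennreal \<bar>x\<bar> * (\<integral>\<^sup>+t. k (x, x * t) \<partial>lborel)"
      by (subst nn_integral_real_affine[where c = x and t = 0]) simp_all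
    then show "(\<integral>\<^sup>+y. k (x, y) \<partial>lborel) = (\<integral>\<^sup>+t. ennreal \<bar>x\<bar> * k (x, x * t) \<partial>lborel)"
      by (simp add: nn_integral_cmult)
  qed
  also have "\<dots> = (\<integral>\<^sup>+t. \<integral>\<^sup>+x. ennreal \<bar>x\<bar> * k (x, x * t) \<partial>lborel \<partial>lborel)"
    by (rule lborel_pair.Fubini'[symmetric]) measurable
  also have "\<dots> = (\<integral>\<^sup>+t. \<integral>\<^sup>+r. ennreal \<bar>r\<bar> * (ennreal (1 / (1 + t\<^sup>2)) * k (r / ?q t, r * t / ?q t)) \<partial>lborel \<partial>lborel)"
  proof (rule nn_integral_cong)
    fix t :: real
    have "(\<integral>\<^sup>+x. ennreal \<bar>x\<bar> * k (x, x * t) \<partial>lborel) =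
        ennreal (1 / ?q t) * (\<integral>\<^sup>+r. ennreal (\<bar>r\<bar> / ?q t) * k (r / ?q t, r * t / ?q t) \<partial>lborel)"
      using q[of t] by (subst nn_integral_real_affine[where c = "1 / ?q t" and t = 0]) (simp_all add: abs_mult)
    also have "\<dots> = (\<integral>\<^sup>+r. ennreal (1 / ?q t) * (ennreal (\<bar>r\<bar> / ?q t) * k (r / ?q t, r * t / ?q t)) \<partial>lborel)"
      by (rule nn_integral_cmult[symmetric]) measurable
    also have "\<dots> = (\<integral>\<^sup>+r. ennreal \<bar>r\<bar> * (ennreal (1 / (1 + t\<^sup>2)) * k (r / ?q t, r * t / ?q t)) \<partial>lborel)"
    proof (intro nn_integral_cong)
      fix r :: real
      have "1 / ?q t * (\<bar>r\<bar> / ?q t) = \<bar>r\<bar> * (1 / (1 + t\<^sup>2))" by (simp add: power2_eq_square)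
      then have "ennreal (1 / ?q t) * ennreal (\<bar>r\<bar> / ?q t) = ennreal \<bar>r\<bar> * ennreal (1 / (1 + t\<^sup>2))"
        using q[of t] by (simp only: ennreal_mult[symmetric] abs_ge_zero divide_nonneg_pos zero_le_one less_imp_le zero_le_divide_1_iff)
          (simp add: ennreal_mult[symmetric])
      then show "ennreal (1 / ?q t) * (ennreal (\<bar>r\<bar> / ?q t) * k (r / ?q t, r * t / ?q t)) =
        ennreal \<bar>r\<bar> * (ennreal (1 / (1 + t\<^sup>2)) * k (r / ?q t, r * t / ?q t))"
        by (simp only: mult.assoc[symmetric])
    qed
    finally show "(\<integral>\<^sup>+x. ennreal \<bar>x\<bar> * k (x, x * t) \<partial>lborel) =
      (\<integral>\<^sup>+r. ennreal \<bar>r\<bar> * (ennreal (1 / (1 + t\<^sup>2)) * k (r / ?q t, r * t / ?q t)) \<partial>lborel)" .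
  qed
  also have "\<dots> = (\<integral>\<^sup>+r. \<integral>\<^sup>+t. ennreal \<bar>r\<bar> * (ennreal (1 / (1 + t\<^sup>2)) * k (r / ?q t, r * t / ?q t)) \<partial>lborel \<partial>lborel)"
    by (rule lborel_pair.Fubini') measurable
  also have "\<dots> = (\<integral>\<^sup>+r. ennreal \<bar>r\<bar> * (\<integral>\<^sup>+t. ennreal (1 / (1 + t\<^sup>2)) * k (r / ?q t, r * t / ?q t) \<partial>lborel) \<partial>lborel)"
    by (intro nn_integral_cong nn_integral_cmult) measurable
  \<comment> \<open>A slope \<open>t\<close> describes a full line through the origin. Folding onto
    \<open>r >= 0\<close> puts the two opposite points at distance \<open>r\<close> on that line
    side by side.\<close>
  also have "\<dots> = (\<integral>\<^sup>+r. (ennreal \<bar>r\<bar> * (\<integral>\<^sup>+t. ennreal (1 / (1 + t\<^sup>2)) * k (r / ?q t, r * t / ?q t) \<partial>lborel) +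
      ennreal \<bar>- r\<bar> * (\<integral>\<^sup>+t. ennreal (1 / (1 + t\<^sup>2)) * k (- r / ?q t, - r * t / ?q t) \<partial>lborel)) * indicator {0..} r \<partial>lborel)"
    by (rule nn_integral_lborel_fold) measurable
  also have "\<dots> = (\<integral>\<^sup>+r. ennreal r * indicator {0..} r *
       (\<integral>\<^sup>+t. ennreal (1 / (1 + t\<^sup>2)) *
          (k (r / ?q t, r * t / ?q t) + k (- r / ?q t, - r * t / ?q t)) \<partial>lborel) \<partial>lborel)"
    by (intro nn_integral_cong)
       (auto simp: distrib_left nn_integral_add simp del: divide_minus_left mult_minus_left split: split_indicator)
  finally show ?thesis .
qed

text \<open>This passes from vectors to pairs, where iterated integrals are available. Lebesgue
  measure is determined by the volumes of boxes, and a box pulls back to a product of two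
  intervals.\<close>

lemma lborel_eq_distr_vec2:
  "(lborel :: (real^2) measure) = distr lborel borel (\<lambda>p. fst p *\<^sub>R axis 1 1 + snd p *\<^sub>R axis 2 1)"
proof (rule lborel_eqI)
  fix l u :: "real^2" assume lu: "\<And>b. b \<in> Basis \<Longrightarrow> l \<bullet> b \<le> u \<bullet> b"
  have B: "Basis = {axis 1 1, axis 2 (1::real) :: real^2}"
    by (auto simp: Basis_vec_def UNIV_2)
  have ne: "axis 1 1 \<noteq> (axis 2 1 :: real^2)" by (simp add: axis_eq_axis)
  have [measurable]: "(\<lambda>p. fst p *\<^sub>R axis 1 1 + snd p *\<^sub>R axis 2 1 :: real^2) \<in> borel_measurable borel"
    by (intro borel_measurable_continuous_onI continuous_intros)
  have "(\<lambda>p. fst p *\<^sub>R axis 1 1 + snd p *\<^sub>R axis 2 1) -` box l u = box (l $ 1, l $ 2) (u $ 1, u $ 2)"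
    by (auto simp: mem_box_cart box_prod forall_2 axis_def)
  moreover have "emeasure lborel (box (l $ 1, l $ 2) (u $ 1, u $ 2)) = ennreal ((u $ 1 - l $ 1) * (u $ 2 - l $ 2))"
  proof -
    have "l $ 1 \<le> u $ 1" "l $ 2 \<le> u $ 2" using lu[of "axis 1 1"] lu[of "axis 2 1"] by (auto simp: B inner_axis)
    then show ?thesis
      unfolding box_prod lborel_prod[symmetric]
      by (subst lborel.emeasure_pair_measure_Times) (simp_all add: ennreal_mult)
  qed
  ultimately show "emeasure (distr lborel borel (\<lambda>p. fst p *\<^sub>R axis 1 1 + snd p *\<^sub>R axis 2 1)) (box l u) = ennreal (\<Prod>b\<in>Basis. (u - l) \<bullet> b)"
    by (subst emeasure_distr) (simp_all add: B ne inner_axis)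
qed simp

text \<open>This serves to rotate \<open>y0\<close> onto the first coordinate axis. The preimage of
  a box is its image under the inverse map, again orthogonal, and such images preserve Lebesgue
  measure.\<close>

lemma lborel_distr_orthogonal:
  fixes T :: "real^'n::{finite,wellorder} \<Rightarrow> real^'n::_"
  assumes "orthogonal_transformation T"
  shows "distr lborel borel T = lborel"
proof (rule lborel_eqI[symmetric])
  fix l u :: "real^'n::{finite,wellorder}" assume lu: "\<And>b. b \<in> Basis \<Longrightarrow> l \<bullet> b \<le> u \<bullet> b"
  have [measurable]: "T \<in> borel_measurable borel"
    using orthogonal_transformation_linear[OF assms]
    by (intro borel_measurable_continuous_onI linear_continuous_on linear_linear[THEN iffD2])
  have vim: "T -` box l u = inv T ` box l u"
    using orthogonal_transformation_bij[OF assms] by (simp add: bij_vimage_eq_inv_image)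
  have o: "orthogonal_transformation (inv T)" by (rule orthogonal_transformation_inv[OF assms])
  have m: "inv T ` box l u \<in> lmeasurable" by (rule measurable_orthogonal_image[OF o]) simp
  have "T -` box l u \<in> sets borel" using measurable_sets_borel[of T borel "box l u"] by simp
  then have "emeasure lborel (T -` box l u) = emeasure lebesgue (T -` box l u)" by simp
  also have "\<dots> = ennreal (measure lebesgue (inv T ` box l u))"
    unfolding vim using m by (intro emeasure_eq_measure2) (auto simp: fmeasurable_def)
  also have "\<dots> = ennreal (measure lebesgue (box l u))" by (simp add: measure_orthogonal_image[OF o])
  also have "\<dots> = ennreal (\<Prod>b\<in>Basis. (u - l) \<bullet> b)" using lu by simp
  finally show "emeasure (distr lborel borel T) (box l u) = ennreal (\<Prod>b\<in>Basis. (u - l) \<bullet> b)"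
    by (simp add: emeasure_distr)
qed simp

subsection \<open>The denominator of kappa and the arctangent term\<close>

text \<open>The variable is complex so that the differentiation rules for \<open>csqrt\<close> and
  \<open>Ln\<close> apply; only real arguments are of interest.\<close>

definition ksqrt :: "real \<Rightarrow> real \<Rightarrow> complex \<Rightarrow> complex" where
  "ksqrt s d z = csqrt ((of_real s + \<i> * (z\<^sup>2 + of_real (d\<^sup>2)))\<^sup>2 + 4 * z\<^sup>2 * of_real (d\<^sup>2))"

definition phase :: "real \<Rightarrow> real \<Rightarrow> complex \<Rightarrow> complex" where
  "phase s d z = - \<i> * (ksqrt s d z + (of_real s + \<i> * (z\<^sup>2 - of_real (d\<^sup>2))))\<^sup>2"

lemma ksqrt_power2:
  "(ksqrt s d z)\<^sup>2 = (of_real s + \<i> * (z\<^sup>2 + of_real (d\<^sup>2)))\<^sup>2 + 4 * z\<^sup>2 * of_real (d\<^sup>2)"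
  by (simp add: ksqrt_def)

lemma Re_radicand:
  "Re ((of_real s + \<i> * ((of_real r)\<^sup>2 + of_real (d\<^sup>2)))\<^sup>2 + 4 * (of_real r)\<^sup>2 * of_real (d\<^sup>2))
     = s\<^sup>2 - (r\<^sup>2 - d\<^sup>2)\<^sup>2"
  by (simp add: power2_eq_square algebra_simps)

lemma Im_radicand:
  "Im ((of_real s + \<i> * ((of_real r)\<^sup>2 + of_real (d\<^sup>2)))\<^sup>2 + 4 * (of_real r)\<^sup>2 * of_real (d\<^sup>2))
     = 2 * s * (r\<^sup>2 + d\<^sup>2)"
  by (simp add: power2_eq_square algebra_simps)

text \<open>The imaginary part vanishes only for \<open>r = d = 0\<close>, where the real part is
  \<open>s^2 > 0\<close>. Hence the principal root is differentiable along the whole real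
  axis.\<close>

lemma radicand_not_nonpos:
  assumes "0 < s"
  shows "(of_real s + \<i> * ((of_real r)\<^sup>2 + of_real (d\<^sup>2)))\<^sup>2 + 4 * (of_real r)\<^sup>2 * of_real (d\<^sup>2) \<notin> \<real>\<^sub>\<le>\<^sub>0"
proof (cases "r = 0 \<and> d = 0")
  case True
  then show ?thesis
    using assms unfolding complex_nonpos_Reals_iff Re_radicand Im_radicand by simp
next
  case False
  then have "2 * s * (r\<^sup>2 + d\<^sup>2) \<noteq> 0" using assms by (simp add: sum_power2_eq_zero_iff)
  then show ?thesis
    unfolding complex_nonpos_Reals_iff Re_radicand Im_radicand by blast
qed

text \<open>A principal root has nonnegative real part, and a root on the imaginary axis would have
  a nonpositive real square.\<close>

lemma Re_ksqrt_pos: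
  assumes "0 < s"
  shows "0 < Re (ksqrt s d (of_real r))"
proof -
  let ?w = "ksqrt s d (of_real r)"
  have "Re ?w \<noteq> 0"
  proof
    assume "Re ?w = 0"
    then have "?w\<^sup>2 \<in> \<real>\<^sub>\<le>\<^sub>0" by (simp add: complex_nonpos_Reals_iff Re_power2 Im_power2)
    then show False using radicand_not_nonpos[OF assms] by (simp add: ksqrt_power2)
  qed
  moreover have "0 \<le> Re ?w" using csqrt_principal unfolding ksqrt_def by (metis less_eq_real_def order_refl)
  ultimately show ?thesis by simp
qed

lemma ksqrt_Re_Im:
  fixes s d r :: real
  defines "w \<equiv> ksqrt s d (of_real r)"
  shows "(Re w)\<^sup>2 - (Im w)\<^sup>2 = s\<^sup>2 - (r\<^sup>2 - d\<^sup>2)\<^sup>2" "Re w * Im w = s * (r\<^sup>2 + d\<^sup>2)"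
proof -
  show "(Re w)\<^sup>2 - (Im w)\<^sup>2 = s\<^sup>2 - (r\<^sup>2 - d\<^sup>2)\<^sup>2"
    using arg_cong[OF ksqrt_power2[of s d "of_real r"], of Re] unfolding Re_radicand w_def by (simp add: Re_power2)
  show "Re w * Im w = s * (r\<^sup>2 + d\<^sup>2)"
    using arg_cong[OF ksqrt_power2[of s d "of_real r"], of Im] unfolding Im_radicand w_def by (simp add: Im_power2)
qed

lemma Im_ksqrt_nonneg:
  assumes "0 < s"
  shows "0 \<le> Im (ksqrt s d (of_real r))"
  using ksqrt_Re_Im(2)[of s d r] Re_ksqrt_pos[OF assms, of d r] assms
  by (metis add_nonneg_nonneg less_eq_real_def mult_nonneg_nonneg zero_le_mult_iff zero_le_power2 not_less)

text \<open>Otherwise \<open>Im w <= d^2 - r^2\<close>, and the formula for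
  \<open>(Re w)^2 - (Im w)^2\<close> yields \<open>Re w <= s\<close>. Then
  \<open>Re w * Im w <= s * (d^2 - r^2)\<close>, which for \<open>r\<close> nonzero is less than the
  true value \<open>s * (r^2 + d^2)\<close>.\<close>

lemma Im_ksqrt_add_pos:
  assumes "0 < s" "r \<noteq> 0"
  shows "0 < Im (ksqrt s d (of_real r)) + (r\<^sup>2 - d\<^sup>2)"
proof (rule ccontr)
  let ?w = "ksqrt s d (of_real r)"
  assume "\<not> ?thesis"
  then have le: "Im ?w \<le> d\<^sup>2 - r\<^sup>2" by simp
  have im: "0 \<le> Im ?w" by (rule Im_ksqrt_nonneg[OF assms(1)])
  have "(Im ?w)\<^sup>2 \<le> (r\<^sup>2 - d\<^sup>2)\<^sup>2" using power_mono[OF le im, of 2] by (simp add: power2_commute)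
  then have "(Re ?w)\<^sup>2 \<le> s\<^sup>2" using ksqrt_Re_Im(1)[of s d r] by simp
  then have "Re ?w \<le> s" using assms(1) by (simp add: power2_le_iff_abs_le)
  then have "Re ?w * Im ?w \<le> s * (d\<^sup>2 - r\<^sup>2)" using le im assms(1) by (intro mult_mono) auto
  moreover have "s * (d\<^sup>2 - r\<^sup>2) < s * (r\<^sup>2 + d\<^sup>2)" using assms by simp
  ultimately show False using ksqrt_Re_Im(2)[of s d r] by simp
qed

text \<open>The real part of \<open>- \<i> * z^2\<close> is \<open>2 * Re z * Im z\<close>, and for
  \<open>z = w + v\<close> both factors are positive. The argument of the phase is therefore an
  ordinary arctangent.\<close>

lemma Re_phase_pos:
  assumes "0 < s" "r \<noteq> 0"
  shows "0 < Re (phase s d (of_real r))"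
proof -
  have "Re (phase s d (of_real r)) =
    2 * (Re (ksqrt s d (of_real r)) + s) * (Im (ksqrt s d (of_real r)) + (r\<^sup>2 - d\<^sup>2))"
    by (simp add: phase_def power2_eq_square algebra_simps)
  then show ?thesis
    using Im_ksqrt_add_pos[OF assms] Re_ksqrt_pos[OF assms(1)] assms(1)
    by (simp add: add_pos_pos)
qed

lemma ksqrt_0: "0 < s \<Longrightarrow> ksqrt s d 0 = of_real s + \<i> * of_real (d\<^sup>2)"
  unfolding ksqrt_def by (simp add: csqrt_square)

lemma phase_0: "0 < s \<Longrightarrow> phase s d 0 = - 4 * \<i> * of_real (s\<^sup>2)"
  by (simp add: phase_def ksqrt_0 power2_eq_square algebra_simps)

text \<open>At \<open>r = 0\<close> the real part is zero, but the phase lies on the negative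
  imaginary axis and so still avoids the branch cut of \<open>Ln\<close>.\<close>

lemma phase_not_nonpos:
  assumes "0 < s"
  shows "phase s d (of_real r) \<notin> \<real>\<^sub>\<le>\<^sub>0"
proof (cases "r = 0")
  case True
  then show ?thesis using assms by (simp add: phase_0 complex_nonpos_Reals_iff)
next
  case False
  then show ?thesis using Re_phase_pos[OF assms False, of d] by (simp add: complex_nonpos_Reals_iff)
qed

text \<open>Differentiating \<open>w^2 = A^2 + 4 r^2 d^2\<close> gives
  \<open>2 w w' = 4 \<i> r (A - 2 \<i> d^2)\<close>, and \<open>A - 2 \<i> d^2 = v\<close>.\<close>

lemma ksqrt_has_field_derivative:
  fixes s d r :: real
  assumes "0 < s"
  shows "(ksqrt s d has_field_derivative
           (2 * \<i> * of_real r * (of_real s + \<i> * ((of_real r)\<^sup>2 - of_real (d\<^sup>2))))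
             / ksqrt s d (of_real r)) (at (of_real r))"
proof -
  define R where "R z = (of_real s + \<i> * (z\<^sup>2 + of_real (d\<^sup>2)))\<^sup>2 + 4 * z\<^sup>2 * of_real (d\<^sup>2)" for z :: complex
  have "(R has_field_derivative
      2 * (2 * \<i> * of_real r * (of_real s + \<i> * ((of_real r)\<^sup>2 - of_real (d\<^sup>2))))) (at (of_real r))"
    unfolding R_def[abs_def]
    by (rule derivative_eq_intros refl)+ (simp add: complex_eq_iff algebra_simps power2_eq_square)
  moreover have "R (of_real r) \<notin> \<real>\<^sub>\<le>\<^sub>0" unfolding R_def by (rule radicand_not_nonpos[OF assms])
  ultimately have "((\<lambda>z. csqrt (R z)) has_field_derivative
      inverse (2 * csqrt (R (of_real r))) * (2 * (2 * \<i> * of_real r * (of_real s + \<i> * ((of_real r)\<^sup>2 - of_real (d\<^sup>2)))))) (at (of_real r))"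
    using has_field_derivative_csqrt by (intro DERIV_chain2[where f = csqrt and g = R])
  moreover have "csqrt (R z) = ksqrt s d z" for z by (simp add: R_def ksqrt_def)
  ultimately have "((\<lambda>z. ksqrt s d z) has_field_derivative
      inverse (2 * ksqrt s d (of_real r)) * (2 * (2 * \<i> * of_real r * (of_real s + \<i> * ((of_real r)\<^sup>2 - of_real (d\<^sup>2)))))) (at (of_real r))"
    by (simp only:)
  then show ?thesis by (rule DERIV_cong) (simp only: divide_inverse inverse_mult_distrib, simp)
qed

lemma Ln_phase_has_field_derivative:
  fixes s d r :: real
  assumes "0 < s"
  shows "((\<lambda>z. Ln (phase s d z)) has_field_derivative 4 * \<i> * of_real r / ksqrt s d (of_real r)) (at (of_real r))"
proof -
  let ?w = "ksqrt s d (of_real r)" and ?v = "of_real s + \<i> * ((of_real r)\<^sup>2 - of_real (d\<^sup>2))"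
  have w: "?w \<noteq> 0" using Re_ksqrt_pos[OF assms, of d r] by auto
  have wv: "?w + ?v \<noteq> 0" using Re_ksqrt_pos[OF assms, of d r] assms
    by (auto simp: complex_eq_iff)
  have "((\<lambda>z. Ln (phase s d z)) has_field_derivative
      (- \<i> * (2 * (?w + ?v) * ((2 * \<i> * of_real r * ?v) / ?w + \<i> * (2 * of_real r)))) * inverse (phase s d (of_real r))) (at (of_real r))"
    by ((rule derivative_eq_intros phase_not_nonpos[OF assms])+, unfold phase_def[abs_def],
        (rule derivative_eq_intros refl ksqrt_has_field_derivative[OF assms])+)
       (simp_all add: algebra_simps)
  also have "(- \<i> * (2 * (?w + ?v) * ((2 * \<i> * of_real r * ?v) / ?w + \<i> * (2 * of_real r)))) * inverse (phase s d (of_real r))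
     = 4 * \<i> * of_real r / ?w"
  proof -
    \<comment> \<open>Here \<open>2 * \<i> * z\<close> is the derivative of \<open>v\<close>. Since
      \<open>w' + v' = v' (w + v) / w\<close>, the factor \<open>w + v\<close> cancels against the
      square.\<close>
    have *: "(- \<i> * (2 * (w + v) * ((2 * \<i> * z * v) / w + \<i> * (2 * z)))) * inverse (- \<i> * (w + v)\<^sup>2) = 4 * \<i> * z / w"
      if "w \<noteq> 0" "w + v \<noteq> 0" for w v z :: complex
    proof -
      have "(2 * \<i> * z * v) / w + \<i> * (2 * z) = 2 * \<i> * z * (w + v) / w"
        using that(1) by (simp add: field_simps)
      then show ?thesis using that by (simp add: divide_simps power2_eq_square)
    qed
    show ?thesis unfolding phase_def by (rule *[OF w wv])
  qed
  finally show ?thesis .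
qed

section \<open>Derivative, monotonicity and limit of the argument of the phase\<close>

lemma Im_Ln_phase_has_real_derivative:
  assumes "0 < s"
  shows "((\<lambda>r. Im (Ln (phase s d (of_real r)))) has_real_derivative
           4 * r * Re (1 / ksqrt s d (of_real r))) (at r)"
proof -
  have "((\<lambda>r. Im (Ln (phase s d (of_real r)))) has_vector_derivative
      Im (4 * \<i> * of_real r / ksqrt s d (of_real r))) (at r)"
    by (intro bounded_linear.has_vector_derivative[OF bounded_linear_Im]
        has_vector_derivative_real_field Ln_phase_has_field_derivative assms)
  moreover have "Im (4 * \<i> * of_real r / ksqrt s d (of_real r)) = 4 * r * Re (1 / ksqrt s d (of_real r))"
  proof -
    have "4 * \<i> * of_real r / ksqrt s d (of_real r) = \<i> * (of_real (4 * r) * (1 / ksqrt s d (of_real r)))"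
      by simp
    then show ?thesis by (simp only: Im_i_times times_complex.sel Re_complex_of_real Im_complex_of_real) simp
  qed
  ultimately show ?thesis by (simp add: has_real_derivative_iff_has_vector_derivative)
qed

lemma Im_Ln_phase_mono:
  assumes "0 < s" "0 \<le> r" "r \<le> r'"
  shows "Im (Ln (phase s d (of_real r))) \<le> Im (Ln (phase s d (of_real r')))"
proof (rule DERIV_nonneg_imp_nondecreasing[OF assms(3)])
  fix x assume "r \<le> x" "x \<le> r'"
  then have "0 \<le> 4 * x * Re (1 / ksqrt s d (of_real x))"
    using Re_ksqrt_pos[OF assms(1), of d x] assms(2) by (simp add: Re_divide)
  then show "\<exists>y. ((\<lambda>r. Im (Ln (phase s d (of_real r)))) has_real_derivative y) (at x) \<and> 0 \<le> y"
    using Im_Ln_phase_has_real_derivative[OF assms(1)] by blast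
qed

text \<open>A nondecreasing function bounded by \<open>pi\<close> tends to its supremum. The limit
  enters the boundary term at infinity and the bound on the mean.\<close>

lemma Im_Ln_phase_convergent:
  assumes "0 < s"
  shows "\<exists>L. ((\<lambda>r. Im (Ln (phase s d (of_real r)))) \<longlongrightarrow> L) at_top"
proof -
  let ?G = "\<lambda>r. Im (Ln (phase s d (of_real r)))"
  let ?L = "SUP r\<in>{0..}. ?G r"
  have nz: "phase s d (of_real r) \<noteq> 0" for r using phase_not_nonpos[OF assms, of d r] by auto
  have bdd: "bdd_above (?G ` {0..})"
    using Im_Ln_le_pi[OF nz] by (intro bdd_aboveI[of _ pi]) auto
  have "(?G \<longlongrightarrow> ?L) at_top"
  proof (rule order_tendstoI)
    fix a assume "a < ?L"
    then obtain r where "0 \<le> r" "a < ?G r" using bdd by (auto simp: less_cSUP_iff)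
    then have "a < ?G x" if "r \<le> x" for x
      using Im_Ln_phase_mono[OF assms \<open>0 \<le> r\<close> that, of d] by linarith
    then show "\<forall>\<^sub>F x in at_top. a < ?G x" by (auto simp: eventually_at_top_linorder)
  next
    fix a assume "?L < a"
    then have "?G x < a" if "0 \<le> x" for x
      using cSUP_upper[OF _ bdd, of x] that by fastforce
    then show "\<forall>\<^sub>F x in at_top. ?G x < a" by (auto simp: eventually_at_top_linorder)
  qed
  then show ?thesis by blast
qed

section \<open>The arctangent of \<open>A4\<close> as the argument of the phase\<close>

lemma kappa_eq:
  "kappa r c y = - \<i> * (of_real (sqrt c) + \<i> * ((of_real r)\<^sup>2 - of_real ((norm y)\<^sup>2)))
                   / ksqrt (sqrt c) (norm y) (of_real r)"
  by (simp add: kappa_def ksqrt_def algebra_simps)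

text \<open>With \<open>\<mu> = v / w\<close> one has \<open>\<kappa> = - \<i> \<mu>\<close>, and
  the phase is a positive multiple of \<open>(1 + \<mu>) * cnj (1 - \<mu>)\<close>, whose imaginary
  and real parts are \<open>2 * Im \<mu>\<close> and \<open>1 - (cmod \<mu>)^2\<close>. The multiple
  comes from \<open>w^2 - v^2 = 4 \<i> s d^2\<close>, which is nonzero because \<open>y\<close> is.
  At \<open>r = 0\<close> both denominators vanish and both quotients are 0 by convention.\<close>

lemma arctan_quotient_eq:
  assumes "0 < c" "y \<noteq> 0"
  shows "arctan_quotient r c y =
    arctan (Im (phase (sqrt c) (norm y) (of_real r)) / Re (phase (sqrt c) (norm y) (of_real r)))"
proof -
  define s d where "s = sqrt c" and "d = norm y"
  have s: "0 < s" and d: "0 < d" using assms by (simp_all add: s_def d_def)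
  define w v where "w = ksqrt s d (of_real r)" and "v = of_real s + \<i> * ((of_real r)\<^sup>2 - of_real (d\<^sup>2))"
  have w: "w \<noteq> 0" using Re_ksqrt_pos[OF s, of d r] by (auto simp: w_def)
  have wv: "w\<^sup>2 - v\<^sup>2 = 4 * \<i> * of_real (s * d\<^sup>2)"
    unfolding w_def v_def ksqrt_power2 by (simp add: complex_eq_iff power2_eq_square algebra_simps)
  define \<mu> where "\<mu> = v / w"
  have kap: "kappa r c y = - \<i> * \<mu>"
    by (simp add: kappa_eq s_def d_def w_def v_def \<mu>_def)
  have "w \<noteq> v" using wv s d by auto
  then have ne: "1 - \<mu> \<noteq> 0" using w by (simp add: \<mu>_def)
  define k where "k = 4 * s * d\<^sup>2 / (cmod (1 - \<mu>))\<^sup>2"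
  have k: "k \<noteq> 0" using s d ne by (simp add: k_def)
  have "phase s d (of_real r) = - \<i> * (w + v)\<^sup>2" by (simp add: phase_def w_def v_def)
  also have "\<dots> = of_real (4 * s * d\<^sup>2) * ((w + v)\<^sup>2 / (w\<^sup>2 - v\<^sup>2))"
    unfolding wv using s d by (simp add: field_simps)
  also have "(w + v)\<^sup>2 / (w\<^sup>2 - v\<^sup>2) = (1 + \<mu>) / (1 - \<mu>)"
  proof -
    have f: "w\<^sup>2 - v\<^sup>2 = (w + v) * (w - v)" by (simp add: power2_eq_square algebra_simps)
    have "w\<^sup>2 - v\<^sup>2 \<noteq> 0" unfolding wv using s d by simp
    then have "w + v \<noteq> 0" "w - v \<noteq> 0" unfolding f by auto
    then show ?thesis unfolding f \<mu>_def using w by (simp add: divide_simps power2_eq_square)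
  qed
  also have "(1 + \<mu>) / (1 - \<mu>) = (1 + \<mu>) * cnj (1 - \<mu>) / of_real ((cmod (1 - \<mu>))\<^sup>2)"
    by (rule complex_div_cnj)
  finally have ph: "phase s d (of_real r) = of_real k * ((1 + \<mu>) * cnj (1 - \<mu>))"
    by (simp add: k_def)
  have "Im (phase s d (of_real r)) = k * (2 * Im \<mu>)" "Re (phase s d (of_real r)) = k * (1 - (cmod \<mu>)\<^sup>2)"
    unfolding ph cmod_power2 by (simp_all add: algebra_simps power2_eq_square)
  then have "Im (phase s d (of_real r)) / Re (phase s d (of_real r)) = 2 * Im \<mu> / (1 - (cmod \<mu>)\<^sup>2)"
    using k by simp
  moreover have "Re (kappa r c y) = Im \<mu>" "cmod (kappa r c y) = cmod \<mu>"
    unfolding kap by (simp_all add: norm_mult)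
  ultimately show ?thesis by (simp add: arctan_quotient_def s_def d_def)
qed

text \<open>For \<open>r > 0\<close> the phase lies in the right half-plane, where its argument is
  the arctangent of the quotient of its parts. It depends continuously on \<open>norm y\<close> down
  to 0, so it also gives the limit that defines the term at \<open>y0 = 0\<close>.\<close>

lemma arctan_term_eq:
  assumes "0 < c" "0 < r"
  shows "arctan_term r c y0 = Im (Ln (phase (sqrt c) (norm y0) (of_real r)))"
proof -
  define s where "s = sqrt c"
  have s: "0 < s" using assms by (simp add: s_def)
  have pos: "0 < Re (phase s d (of_real r))" for d using Re_phase_pos[OF s, of r d] assms by simp
  have eq: "Im (Ln (phase s d (of_real r))) = arctan (Im (phase s d (of_real r)) / Re (phase s d (of_real r)))" for d
  proof -
    have "phase s d (of_real r) \<noteq> 0" using pos[of d] by auto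
    then show ?thesis using pos[of d] by (simp add: Im_Ln_eq)
  qed
  show ?thesis
  proof (cases "y0 = 0")
    case False
    then show ?thesis
      using arctan_quotient_eq[OF assms(1) False] eq by (simp add: arctan_term_def s_def)
  next
    case True
    have k: "((\<lambda>y::real^2. ksqrt s (norm y) (of_real r)) \<longlongrightarrow> ksqrt s (norm (0::real^2)) (of_real r)) (at 0)"
      unfolding ksqrt_def
      by (intro isCont_tendsto_compose[where g = csqrt] continuous_at_csqrt radicand_not_nonpos[OF s] tendsto_intros)
    have "((\<lambda>y::real^2. phase s (norm y) (of_real r)) \<longlongrightarrow> phase s (norm (0::real^2)) (of_real r)) (at 0)"
      unfolding phase_def by (intro tendsto_intros k)
    then have "((\<lambda>y::real^2. Im (Ln (phase s (norm y) (of_real r)))) \<longlongrightarrow> Im (Ln (phase s (norm (0::real^2)) (of_real r)))) (at 0)"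
      by (intro tendsto_intros phase_not_nonpos[OF s])
    then have "((\<lambda>y::real^2. arctan_quotient r c y) \<longlongrightarrow> Im (Ln (phase s (norm (0::real^2)) (of_real r)))) (at 0)"
      by (rule Lim_transform_eventually)
         (auto simp: eventually_at_filter arctan_quotient_eq[OF assms(1)] eq s_def[symmetric])
    then show ?thesis
      using True by (simp add: arctan_term_def tendsto_Lim s_def)
  qed
qed

subsection \<open>The angular integral\<close>

text \<open>Formally the antiderivative is \<open>(2 / w) * arctan (A * t / w)\<close>, which runs
  from 0 to \<open>pi / w\<close> in the limit. Expressing it by two logarithms makes the branch
  cuts easy to control.\<close>

lemma angular_integral_half:
  fixes s d r :: real
  assumes "0 < s"
  defines "A \<equiv> of_real s + \<i> * of_real (r\<^sup>2 + d\<^sup>2)" and "w \<equiv> ksqrt s d (of_real r)"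
  shows "(\<integral>\<^sup>+t. ennreal (Re (2 * A / (w\<^sup>2 + A\<^sup>2 * of_real (t\<^sup>2)))) * indicator {0..} t \<partial>lborel) = ennreal (pi * Re (1 / w))"
proof -
  have A: "0 < Re A" "0 \<le> Im A" using assms(1) by (simp_all add: A_def)
  have w: "0 < Re w" "0 \<le> Im w" using Re_ksqrt_pos[OF assms(1)] Im_ksqrt_nonneg[OF assms(1)] by (simp_all add: w_def)
  have wA: "w\<^sup>2 = A\<^sup>2 + of_real (4 * r\<^sup>2 * d\<^sup>2)" by (simp add: w_def ksqrt_power2 A_def)
  \<comment> \<open>For \<open>t > 0\<close> this number is in the upper half-plane, and its
    counterpart \<open>w - \<i> * A * t\<close> is in the right half-plane for all
    \<open>t >= 0\<close>.\<close>
  have p: "w + \<i> * A * of_real t \<notin> \<real>\<^sub>\<le>\<^sub>0" if "0 \<le> t" for t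
  proof (cases "t = 0")
    case True then show ?thesis using w by (simp add: complex_nonpos_Reals_iff)
  next
    case False
    then have "0 < Im w + Re A * t" using A w that by (intro add_nonneg_pos mult_pos_pos) auto
    then show ?thesis by (simp add: complex_nonpos_Reals_iff)
  qed
  have m: "0 < Re (w - \<i> * A * of_real t)" if "0 \<le> t" for t
    using A w that by (simp add: add_pos_nonneg)
  then have m': "w - \<i> * A * of_real t \<notin> \<real>\<^sub>\<le>\<^sub>0" if "0 \<le> t" for t
    using that by (meson complex_nonpos_Reals_iff not_le)
  define P where "P t = Re ((Ln (w + \<i> * A * of_real t) - Ln (w - \<i> * A * of_real t)) / (\<i> * w))" for t :: real
  have P': "(P has_real_derivative Re (2 * A / (w\<^sup>2 + A\<^sup>2 * of_real (t\<^sup>2)))) (at t)" if t: "0 \<le> t" for t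
  proof -
    have "((\<lambda>z. Ln (w + \<i> * A * z) - Ln (w - \<i> * A * z)) has_field_derivative
        \<i> * A * inverse (w + \<i> * A * of_real t) - (- (\<i> * A)) * inverse (w - \<i> * A * of_real t)) (at (of_real t))"
      by (rule derivative_eq_intros refl p[OF t] m'[OF t])+ (simp add: divide_inverse mult.commute)
    then have "((\<lambda>z. (Ln (w + \<i> * A * z) - Ln (w - \<i> * A * z)) / (\<i> * w)) has_field_derivative
        (\<i> * A * inverse (w + \<i> * A * of_real t) - (- (\<i> * A)) * inverse (w - \<i> * A * of_real t)) / (\<i> * w)) (at (of_real t))"
      by (rule DERIV_cdivide)
    also have "(\<i> * A * inverse (w + \<i> * A * of_real t) - (- (\<i> * A)) * inverse (w - \<i> * A * of_real t)) / (\<i> * w)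
       = 2 * A / (w\<^sup>2 + A\<^sup>2 * of_real (t\<^sup>2))"
    proof -
      have ne: "w + \<i> * A * of_real t \<noteq> 0" "w - \<i> * A * of_real t \<noteq> 0" "w \<noteq> 0"
        using p[OF t] m'[OF t] w by auto
      have "w\<^sup>2 + A\<^sup>2 * of_real (t\<^sup>2) = (w + \<i> * A * of_real t) * (w - \<i> * A * of_real t)"
        by (simp add: algebra_simps power2_eq_square)
      moreover have "(\<i> * A * inverse x - (- (\<i> * A)) * inverse y) / (\<i> * w) = 2 * A / (x * y)"
        if "x \<noteq> 0" "y \<noteq> 0" "x + y = 2 * w" for x y
      proof -
        have "(\<i> * A * inverse x - (- (\<i> * A)) * inverse y) / (\<i> * w) = A * (x + y) / (x * y) / w"
          using that(1,2) by (simp add: divide_simps) (simp add: algebra_simps)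
        then show ?thesis using that ne by simp
      qed
      ultimately show ?thesis using ne by simp
    qed
    finally have "((\<lambda>t. (Ln (w + \<i> * A * of_real t) - Ln (w - \<i> * A * of_real t)) / (\<i> * w)) has_vector_derivative
        2 * A / (w\<^sup>2 + A\<^sup>2 * of_real (t\<^sup>2))) (at t)"
      by (rule has_vector_derivative_real_field)
    from bounded_linear.has_vector_derivative[OF bounded_linear_Re this]
    show ?thesis by (simp add: P_def[abs_def] has_real_derivative_iff_has_vector_derivative)
  qed
  \<comment> \<open>Dividing both logarithm arguments by \<open>t > 0\<close> leaves the difference
    of the logarithms unchanged, and \<open>w / t\<close> tends to 0.\<close>
  have lim: "(P \<longlongrightarrow> pi * Re (1 / w)) at_top"
  proof -
    have inv: "((\<lambda>t::real. w * of_real (inverse t)) \<longlongrightarrow> w * of_real 0) at_top"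
      by (intro tendsto_intros tendsto_inverse_0_at_top filterlim_ident)
    have "((\<lambda>t. Re ((Ln (w * of_real (inverse t) + \<i> * A) - Ln (w * of_real (inverse t) - \<i> * A)) / (\<i> * w)))
        \<longlongrightarrow> Re ((Ln (w * of_real 0 + \<i> * A) - Ln (w * of_real 0 - \<i> * A)) / (\<i> * w))) at_top"
      using w A by (intro tendsto_intros inv) (auto simp: complex_nonpos_Reals_iff)
    moreover have "\<forall>\<^sub>F t in at_top. Re ((Ln (w * of_real (inverse t) + \<i> * A) - Ln (w * of_real (inverse t) - \<i> * A)) / (\<i> * w)) = P t"
    proof (rule eventually_at_top_linorderI[of 1])
      fix t :: real assume "1 \<le> t"
      then have t: "0 < t" by simp
      have eq: "w + \<i> * A * of_real t = of_real t * (w * of_real (inverse t) + \<i> * A)"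
        "w - \<i> * A * of_real t = of_real t * (w * of_real (inverse t) - \<i> * A)"
        using t by (simp_all add: field_simps)
      have "w + \<i> * A * of_real t \<noteq> 0" "w - \<i> * A * of_real t \<noteq> 0"
        using p[of t] m'[of t] t by fastforce+
      then have "w * of_real (inverse t) + \<i> * A \<noteq> 0" "w * of_real (inverse t) - \<i> * A \<noteq> 0"
        unfolding eq mult_eq_0_iff de_Morgan_disj by blast+
      then have "Ln (of_real t * (w * of_real (inverse t) + \<i> * A)) - Ln (of_real t * (w * of_real (inverse t) - \<i> * A)) =
         Ln (w * of_real (inverse t) + \<i> * A) - Ln (w * of_real (inverse t) - \<i> * A)"
        by (metis Ln_times_of_real[OF t] add_diff_cancel_left)
      then have "Ln (w + \<i> * A * of_real t) - Ln (w - \<i> * A * of_real t) =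
         Ln (w * of_real (inverse t) + \<i> * A) - Ln (w * of_real (inverse t) - \<i> * A)"
        unfolding eq .
      then show "Re ((Ln (w * of_real (inverse t) + \<i> * A) - Ln (w * of_real (inverse t) - \<i> * A)) / (\<i> * w)) = P t"
        by (simp add: P_def)
    qed
    \<comment> \<open>As \<open>Im (\<i> * A) = Re A > 0\<close>, passing to
      \<open>- (\<i> * A)\<close> lowers the principal argument by \<open>pi\<close>.\<close>
    moreover have "Re ((Ln (w * of_real 0 + \<i> * A) - Ln (w * of_real 0 - \<i> * A)) / (\<i> * w)) = pi * Re (1 / w)"
    proof -
      have "\<i> * A \<noteq> 0" using A by auto
      then have "Ln (- (\<i> * A)) = Ln (\<i> * A) - \<i> * pi"
        using A by (subst Ln_minus) auto
      then have "(Ln (w * of_real 0 + \<i> * A) - Ln (w * of_real 0 - \<i> * A)) / (\<i> * w) = of_real pi * (1 / w)"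
        by simp
      then show ?thesis by (simp only: Re_complex_of_real times_complex.sel Im_complex_of_real)
    qed
    ultimately show ?thesis by (simp only:) (rule Lim_transform_eventually)
  qed
  \<comment> \<open>After cancelling \<open>A\<close> the denominator is
    \<open>A * (1 + t^2) + 4 r^2 d^2 / A\<close>. Its real part is nonnegative because
    \<open>A\<close> and \<open>1 / A\<close> have positive real part.\<close>
  have nn: "0 \<le> Re (2 * A / (w\<^sup>2 + A\<^sup>2 * of_real (t\<^sup>2)))" for t :: real
  proof -
    have "w\<^sup>2 + A\<^sup>2 * of_real (t\<^sup>2) = A\<^sup>2 * of_real (1 + t\<^sup>2) + of_real (4 * r\<^sup>2 * d\<^sup>2)"
      unfolding wA by (simp add: algebra_simps)
    then have "2 * A / (w\<^sup>2 + A\<^sup>2 * of_real (t\<^sup>2)) = 2 / (A * of_real (1 + t\<^sup>2) + of_real (4 * r\<^sup>2 * d\<^sup>2) / A)"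
    proof -
      assume *: "w\<^sup>2 + A\<^sup>2 * of_real (t\<^sup>2) = A\<^sup>2 * of_real (1 + t\<^sup>2) + of_real (4 * r\<^sup>2 * d\<^sup>2)"
      have "A \<noteq> 0" using A by auto
      have "A\<^sup>2 * of_real (1 + t\<^sup>2) + of_real (4 * r\<^sup>2 * d\<^sup>2) = A * (A * of_real (1 + t\<^sup>2) + of_real (4 * r\<^sup>2 * d\<^sup>2) / A)"
        using \<open>A \<noteq> 0\<close> by (simp add: field_simps power2_eq_square)
      then show ?thesis unfolding * using \<open>A \<noteq> 0\<close> by simp
    qed
    moreover have "0 \<le> Re (2 / z)" if "0 \<le> Re z" for z using that by (simp add: Re_divide)
    moreover have "0 \<le> Re (A * of_real (1 + t\<^sup>2) + of_real (4 * r\<^sup>2 * d\<^sup>2) / A)"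
    proof -
      have "0 \<le> Re A * (1 + t\<^sup>2)" using A by simp
      moreover have "0 \<le> Re (of_real (4 * r\<^sup>2 * d\<^sup>2) / A)" using A unfolding Re_divide by simp
      ultimately show ?thesis by simp
    qed
    ultimately show ?thesis by simp
  qed
  have "(\<integral>\<^sup>+t. ennreal (Re (2 * A / (w\<^sup>2 + A\<^sup>2 * of_real (t\<^sup>2)))) * indicator {0..} t \<partial>lborel)
      = ennreal (pi * Re (1 / w) - P 0)"
    by (rule nn_integral_FTC_atLeast[OF _ P' nn lim]) measurable
  then show ?thesis by (simp add: P_def)
qed

lemma Re_inverse_add_i:
  fixes s x :: real
  assumes "0 < s"
  shows "1 / (s\<^sup>2 + x\<^sup>2) = Re (1 / (of_real s + \<i> * of_real x)) / s"
  using assms by (simp add: Re_divide power2_eq_square)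

text \<open>With \<open>t\<close> the tangent of the polar angle, \<open>u\<close> is
  \<open>2 r d\<close> times its cosine, so \<open>r^2 + d^2 - u\<close> and
  \<open>r^2 + d^2 + u\<close> are the squared distances of two opposite points of the circle from
  \<open>(d, 0)\<close>. The two fractions combine to \<open>2 * A / (A^2 + u^2)\<close>, and
  \<open>(A^2 + u^2) * (1 + t^2) = w^2 + A^2 * t^2\<close>.\<close>

lemma angular_integrand:
  fixes s d r t :: real
  assumes "0 < s"
  defines "A \<equiv> of_real s + \<i> * of_real (r\<^sup>2 + d\<^sup>2)" and "w \<equiv> ksqrt s d (of_real r)"
    and "u \<equiv> 2 * r * d / sqrt (1 + t\<^sup>2)"
  shows "1 / (1 + t\<^sup>2) * (1 / (s\<^sup>2 + (r\<^sup>2 + d\<^sup>2 - u)\<^sup>2) + 1 / (s\<^sup>2 + (r\<^sup>2 + d\<^sup>2 + u)\<^sup>2))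
       = Re (2 * A / (w\<^sup>2 + A\<^sup>2 * of_real (t\<^sup>2))) / s"
proof -
  have q: "0 < 1 + t\<^sup>2" by (simp add: add_pos_nonneg)
  have u: "u\<^sup>2 * (1 + t\<^sup>2) = 4 * r\<^sup>2 * d\<^sup>2"
    using q by (simp add: u_def power_divide power_mult_distrib)
  have nz: "A - \<i> * of_real u \<noteq> 0" "A + \<i> * of_real u \<noteq> 0"
    using assms(1) by (auto simp: A_def complex_eq_iff)
  have w: "w\<^sup>2 + A\<^sup>2 * of_real (t\<^sup>2) = (A - \<i> * of_real u) * (A + \<i> * of_real u) * of_real (1 + t\<^sup>2)"
  proof -
    have "w\<^sup>2 = A\<^sup>2 + of_real (u\<^sup>2 * (1 + t\<^sup>2))"
      unfolding u by (simp add: w_def ksqrt_power2 A_def)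
    then show ?thesis by (simp add: algebra_simps power2_eq_square)
  qed
  have "1 / (1 + t\<^sup>2) * (1 / (s\<^sup>2 + (r\<^sup>2 + d\<^sup>2 - u)\<^sup>2) + 1 / (s\<^sup>2 + (r\<^sup>2 + d\<^sup>2 + u)\<^sup>2))
    = (Re (1 / (A - \<i> * of_real u)) + Re (1 / (A + \<i> * of_real u))) / (1 + t\<^sup>2) / s"
    unfolding Re_inverse_add_i[OF assms(1)] by (simp add: A_def algebra_simps add_divide_distrib)
  also have "Re (1 / (A - \<i> * of_real u)) + Re (1 / (A + \<i> * of_real u))
    = Re (2 * A / ((A - \<i> * of_real u) * (A + \<i> * of_real u)))"
  proof -
    have "1 / (A - \<i> * of_real u) + 1 / (A + \<i> * of_real u) = 2 * A / ((A - \<i> * of_real u) * (A + \<i> * of_real u))"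
      by (subst add_frac_eq[OF nz]) simp
    then show ?thesis by (metis plus_complex.sel(1))
  qed
  also have "\<dots> / (1 + t\<^sup>2) = Re (2 * A / (w\<^sup>2 + A\<^sup>2 * of_real (t\<^sup>2)))"
    unfolding w using Re_divide_of_real[of "2 * A / ((A - \<i> * of_real u) * (A + \<i> * of_real u))" "1 + t\<^sup>2"] by simp
  finally show ?thesis .
qed

lemma nn_integral_lborel_even:
  fixes f :: "real \<Rightarrow> ennreal"
  assumes [measurable]: "f \<in> borel_measurable borel" and even: "\<And>x. f (- x) = f x"
  shows "(\<integral>\<^sup>+x. f x \<partial>lborel) = 2 * (\<integral>\<^sup>+x. f x * indicator {0..} x \<partial>lborel)"
proof -
  have "(\<integral>\<^sup>+x. f x \<partial>lborel) = (\<integral>\<^sup>+x. 2 * (f x * indicator {0..} x) \<partial>lborel)"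
    unfolding nn_integral_lborel_fold[OF assms(1)] even by (simp add: mult_2 distrib_right)
  also have "\<dots> = 2 * (\<integral>\<^sup>+x. f x * indicator {0..} x \<partial>lborel)"
    by (rule nn_integral_cmult) measurable
  finally show ?thesis .
qed

lemma angular_integral:
  fixes s d r :: real
  assumes s: "0 < s"
  defines "u \<equiv> \<lambda>t. 2 * r * d / sqrt (1 + t\<^sup>2)"
  shows "(\<integral>\<^sup>+t. ennreal (1 / (1 + t\<^sup>2) *
            (1 / (s\<^sup>2 + (r\<^sup>2 + d\<^sup>2 - u t)\<^sup>2) + 1 / (s\<^sup>2 + (r\<^sup>2 + d\<^sup>2 + u t)\<^sup>2))) \<partial>lborel)
       = ennreal (2 * pi / s * Re (1 / ksqrt s d (of_real r)))"
proof -
  define A where "A = of_real s + \<i> * of_real (r\<^sup>2 + d\<^sup>2)"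
  define w where "w = ksqrt s d (of_real r)"
  define f where "f t = ennreal (Re (2 * A / (w\<^sup>2 + A\<^sup>2 * of_real (t\<^sup>2))))" for t :: real
  have [measurable]: "f \<in> borel_measurable borel" unfolding f_def by measurable
  have half: "(\<integral>\<^sup>+t. f t * indicator {0..} t \<partial>lborel) = ennreal (pi * Re (1 / w))"
    unfolding f_def A_def w_def by (rule angular_integral_half[OF s])
  have "(\<integral>\<^sup>+t. ennreal (1 / (1 + t\<^sup>2) *
            (1 / (s\<^sup>2 + (r\<^sup>2 + d\<^sup>2 - u t)\<^sup>2) + 1 / (s\<^sup>2 + (r\<^sup>2 + d\<^sup>2 + u t)\<^sup>2))) \<partial>lborel)
      = (\<integral>\<^sup>+t. ennreal (1 / s) * f t \<partial>lborel)"
  proof (rule nn_integral_cong)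
    fix t :: real
    have "ennreal (x / s) = ennreal (1 / s) * ennreal x" for x
      using s ennreal_mult'[of "1 / s" x] by simp
    then show "ennreal (1 / (1 + t\<^sup>2) *
            (1 / (s\<^sup>2 + (r\<^sup>2 + d\<^sup>2 - u t)\<^sup>2) + 1 / (s\<^sup>2 + (r\<^sup>2 + d\<^sup>2 + u t)\<^sup>2))) = ennreal (1 / s) * f t"
      unfolding u_def angular_integrand[OF s] f_def A_def w_def .
  qed
  also have "\<dots> = ennreal (1 / s) * (\<integral>\<^sup>+t. f t \<partial>lborel)"
    by (rule nn_integral_cmult) measurable
  also have "(\<integral>\<^sup>+t. f t \<partial>lborel) = 2 * (\<integral>\<^sup>+t. f t * indicator {0..} t \<partial>lborel)"
    by (rule nn_integral_lborel_even) (simp_all add: f_def)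
  also have "\<dots> = 2 * ennreal (pi * Re (1 / w))" by (simp only: half)
  also have "ennreal (1 / s) * (2 * ennreal (pi * Re (1 / w))) = ennreal (2 * pi / s * Re (1 / w))"
  proof -
    have "ennreal (1 / s) * (2 * ennreal (pi * Re (1 / w))) = ennreal (1 / s) * ennreal (2 * (pi * Re (1 / w)))"
      by (simp add: ennreal_mult' flip: ennreal_numeral)
    also have "\<dots> = ennreal (1 / s * (2 * (pi * Re (1 / w))))"
      using s by (intro ennreal_mult'[symmetric]) simp
    finally show ?thesis by (simp add: field_simps)
  qed
  finally show ?thesis by (simp add: w_def)
qed

section \<open>Reduction of the planar integral to a radial one\<close>

lemma norm_vec2: "norm (x :: real^2) = sqrt ((x $ 1)\<^sup>2 + (x $ 2)\<^sup>2)"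
  by (simp add: norm_vec_def L2_set_def UNIV_2)

text \<open>A rotation moves \<open>y0\<close> to \<open>(d, 0)\<close> without changing the radial
  weight \<open>G\<close>. In polar coordinates \<open>G r\<close> leaves the inner integral, which
  is then the angular integral above.\<close>

lemma nn_integral_planar:
  fixes G :: "real \<Rightarrow> ennreal" and y0 :: "real^2"
  assumes G[measurable]: "G \<in> borel_measurable borel" and s: "0 < s"
  shows "(\<integral>\<^sup>+x. G (norm x) * ennreal (1 / (s\<^sup>2 + norm (x - y0) ^ 4)) \<partial>lborel) =
    (\<integral>\<^sup>+r. G r * ennreal (2 * pi / s * (r * Re (1 / ksqrt s (norm y0) (of_real r)))) * indicator {0..} r \<partial>lborel)"
proof -
  define d where "d = norm y0"
  define a where "a = (d *\<^sub>R axis 1 1 :: real^2)"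
  have "norm a = norm y0" by (simp add: a_def d_def)
  then obtain T where T: "orthogonal_transformation T" and Ta: "T a = y0"
    using orthogonal_transformation_exists[of a y0] by auto
  have T_norm: "norm (T x) = norm x" for x using T by (simp add: orthogonal_transformation_norm)
  have T_diff: "norm (T x - y0) = norm (x - a)" for x
    using T_norm[of "x - a"] linear_diff[OF orthogonal_transformation_linear[OF T]] Ta by simp
  have [measurable]: "T \<in> borel_measurable borel"
    using orthogonal_transformation_linear[OF T]
    by (intro borel_measurable_continuous_onI linear_continuous_on linear_linear[THEN iffD2])
  have [measurable]: "(\<lambda>p. fst p *\<^sub>R axis 1 1 + snd p *\<^sub>R axis 2 1 :: real^2) \<in> borel_measurable borel"
    by (intro borel_measurable_continuous_onI continuous_intros)
  define k where "k p = G (sqrt ((fst p)\<^sup>2 + (snd p)\<^sup>2)) * ennreal (1 / (s\<^sup>2 + ((fst p - d)\<^sup>2 + (snd p)\<^sup>2)\<^sup>2))"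
    for p :: "real \<times> real"
  have k[measurable]: "k \<in> borel_measurable borel"
    unfolding k_def borel_prod[symmetric] by measurable
  have k': "G (norm x) * ennreal (1 / (s\<^sup>2 + norm (x - a) ^ 4)) = k (x $ 1, x $ 2)" for x :: "real^2"
  proof -
    have "norm (x - a) ^ 4 = ((norm (x - a))\<^sup>2)\<^sup>2" by (simp flip: power_mult)
    also have "(norm (x - a))\<^sup>2 = (x $ 1 - d)\<^sup>2 + (x $ 2)\<^sup>2"
      by (simp add: norm_vec2 a_def axis_def)
    finally show ?thesis by (simp add: k_def norm_vec2)
  qed
  have "(\<integral>\<^sup>+x. G (norm x) * ennreal (1 / (s\<^sup>2 + norm (x - y0) ^ 4)) \<partial>lborel)
      = (\<integral>\<^sup>+x. G (norm x) * ennreal (1 / (s\<^sup>2 + norm (x - y0) ^ 4)) \<partial>distr lborel borel T)"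
    by (simp add: lborel_distr_orthogonal[OF T])
  also have "\<dots> = (\<integral>\<^sup>+x. G (norm x) * ennreal (1 / (s\<^sup>2 + norm (x - a) ^ 4)) \<partial>lborel)"
    by (subst nn_integral_distr) (simp_all add: T_norm T_diff)
  also have "\<dots> = (\<integral>\<^sup>+p. k p \<partial>lborel)"
    by (subst lborel_eq_distr_vec2, subst nn_integral_distr) (simp_all add: k', simp add: axis_def)
  also have "\<dots> = (\<integral>\<^sup>+x. \<integral>\<^sup>+y. k (x, y) \<partial>lborel \<partial>lborel)"
    unfolding lborel_prod[symmetric] by (rule lborel.nn_integral_fst[symmetric]) (simp add: lborel_prod)
  also have "\<dots> = (\<integral>\<^sup>+r. ennreal r * indicator {0..} r *
       (\<integral>\<^sup>+t. ennreal (1 / (1 + t\<^sup>2)) *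
          (k (r / sqrt (1 + t\<^sup>2), r * t / sqrt (1 + t\<^sup>2)) +
           k (- r / sqrt (1 + t\<^sup>2), - r * t / sqrt (1 + t\<^sup>2))) \<partial>lborel) \<partial>lborel)"
    by (rule nn_integral_polar[OF k])
  also have "\<dots> = (\<integral>\<^sup>+r. G r * ennreal (2 * pi / s * (r * Re (1 / ksqrt s (norm y0) (of_real r)))) * indicator {0..} r \<partial>lborel)"
  proof (rule nn_integral_cong)
    fix r :: real
    show "ennreal r * indicator {0..} r *
       (\<integral>\<^sup>+t. ennreal (1 / (1 + t\<^sup>2)) *
          (k (r / sqrt (1 + t\<^sup>2), r * t / sqrt (1 + t\<^sup>2)) +
           k (- r / sqrt (1 + t\<^sup>2), - r * t / sqrt (1 + t\<^sup>2))) \<partial>lborel)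
      = G r * ennreal (2 * pi / s * (r * Re (1 / ksqrt s (norm y0) (of_real r)))) * indicator {0..} r"
    proof (cases "0 \<le> r")
      case r: True
      let ?u = "\<lambda>t. 2 * r * d / sqrt (1 + t\<^sup>2)"
      \<comment> \<open>The sign \<open>e\<close>, equal to 1 or -1, treats the two opposite points
        at once.\<close>
      have kk: "k (e * r / sqrt (1 + t\<^sup>2), e * r * t / sqrt (1 + t\<^sup>2)) = G r * ennreal (1 / (s\<^sup>2 + (r\<^sup>2 + d\<^sup>2 - e * ?u t)\<^sup>2))"
        if "e\<^sup>2 = 1" for e t :: real
      proof -
        have q: "0 < 1 + t\<^sup>2" by (simp add: add_pos_nonneg)
        have sq: "(e * r / sqrt (1 + t\<^sup>2))\<^sup>2 + (e * r * t / sqrt (1 + t\<^sup>2))\<^sup>2 = r\<^sup>2"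
        proof -
          have "(e * r / sqrt (1 + t\<^sup>2))\<^sup>2 + (e * r * t / sqrt (1 + t\<^sup>2))\<^sup>2 = r\<^sup>2 / (1 + t\<^sup>2) + r\<^sup>2 * t\<^sup>2 / (1 + t\<^sup>2)"
            using q that by (simp add: power_divide power_mult_distrib)
          also have "\<dots> = r\<^sup>2 * (1 + t\<^sup>2) / (1 + t\<^sup>2)" by (simp add: algebra_simps add_divide_distrib)
          finally show ?thesis using q by simp
        qed
        have "(e * r / sqrt (1 + t\<^sup>2) - d)\<^sup>2 + (e * r * t / sqrt (1 + t\<^sup>2))\<^sup>2 = r\<^sup>2 + d\<^sup>2 - e * ?u t"
          unfolding power2_diff sq[symmetric] by (simp add: algebra_simps)
        then show ?thesis using r by (simp add: k_def sq)
      qed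
      have "(\<integral>\<^sup>+t. ennreal (1 / (1 + t\<^sup>2)) *
          (k (r / sqrt (1 + t\<^sup>2), r * t / sqrt (1 + t\<^sup>2)) +
           k (- r / sqrt (1 + t\<^sup>2), - r * t / sqrt (1 + t\<^sup>2))) \<partial>lborel)
        = (\<integral>\<^sup>+t. G r * ennreal (1 / (1 + t\<^sup>2) *
            (1 / (s\<^sup>2 + (r\<^sup>2 + d\<^sup>2 - ?u t)\<^sup>2) + 1 / (s\<^sup>2 + (r\<^sup>2 + d\<^sup>2 + ?u t)\<^sup>2))) \<partial>lborel)"
      proof (rule nn_integral_cong)
        fix t :: real
        have q: "0 \<le> 1 / (1 + t\<^sup>2)" "0 \<le> 1 / (s\<^sup>2 + x\<^sup>2)" for x :: real by simp_all
        have "k (r / sqrt (1 + t\<^sup>2), r * t / sqrt (1 + t\<^sup>2)) = G r * ennreal (1 / (s\<^sup>2 + (r\<^sup>2 + d\<^sup>2 - ?u t)\<^sup>2))"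
          "k (- r / sqrt (1 + t\<^sup>2), - r * t / sqrt (1 + t\<^sup>2)) = G r * ennreal (1 / (s\<^sup>2 + (r\<^sup>2 + d\<^sup>2 + ?u t)\<^sup>2))"
          using kk[of 1 t] kk[of "-1" t] by simp_all
        then have "k (r / sqrt (1 + t\<^sup>2), r * t / sqrt (1 + t\<^sup>2)) + k (- r / sqrt (1 + t\<^sup>2), - r * t / sqrt (1 + t\<^sup>2))
          = G r * ennreal (1 / (s\<^sup>2 + (r\<^sup>2 + d\<^sup>2 - ?u t)\<^sup>2) + 1 / (s\<^sup>2 + (r\<^sup>2 + d\<^sup>2 + ?u t)\<^sup>2))"
          by (simp only: ennreal_plus[OF q(2) q(2)] distrib_left)
        then show "ennreal (1 / (1 + t\<^sup>2)) *
          (k (r / sqrt (1 + t\<^sup>2), r * t / sqrt (1 + t\<^sup>2)) +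
           k (- r / sqrt (1 + t\<^sup>2), - r * t / sqrt (1 + t\<^sup>2))) = G r * ennreal (1 / (1 + t\<^sup>2) *
            (1 / (s\<^sup>2 + (r\<^sup>2 + d\<^sup>2 - ?u t)\<^sup>2) + 1 / (s\<^sup>2 + (r\<^sup>2 + d\<^sup>2 + ?u t)\<^sup>2)))"
          using q(1) by (simp only: ennreal_mult') (simp only: mult_ac)
      qed
      also have "\<dots> = G r * ennreal (2 * pi / s * Re (1 / ksqrt s d (of_real r)))"
        by (subst nn_integral_cmult) (simp_all only: angular_integral[OF s], measurable)
      finally have inner: "(\<integral>\<^sup>+t. ennreal (1 / (1 + t\<^sup>2)) *
          (k (r / sqrt (1 + t\<^sup>2), r * t / sqrt (1 + t\<^sup>2)) +
           k (- r / sqrt (1 + t\<^sup>2), - r * t / sqrt (1 + t\<^sup>2))) \<partial>lborel)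
        = G r * ennreal (2 * pi / s * Re (1 / ksqrt s d (of_real r)))" .
      have "2 * pi / s * (r * Re (1 / ksqrt s d (of_real r))) = r * (2 * pi / s * Re (1 / ksqrt s d (of_real r)))"
        by (simp only: mult_ac)
      then have "ennreal (2 * pi / s * (r * Re (1 / ksqrt s d (of_real r)))) =
          ennreal r * ennreal (2 * pi / s * Re (1 / ksqrt s d (of_real r)))"
        by (simp only: ennreal_mult'[OF r])
      then show ?thesis
        unfolding inner d_def using r by (simp add: mult_ac)
    qed simp
  qed
  finally show ?thesis .
qed

subsection \<open>Integration by parts\<close>

text \<open>No sign or absolute integrability of \<open>h\<close> is assumed, as needed for a
  derivative \<open>f\<close> of arbitrary sign. The gauge integral over the half-line is therefore
  obtained from its definition, by comparison with compact intervals \<open>{0..b}\<close>.\<close>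

lemma has_integral_atLeast_FTC:
  fixes H h :: "real \<Rightarrow> real"
  assumes cont: "continuous_on {0..} H"
    and deriv: "\<And>x. 0 < x \<Longrightarrow> (H has_real_derivative h x) (at x)"
    and lim: "(H \<longlongrightarrow> L) at_top"
  shows "(h has_integral (L - H 0)) {0..}"
proof -
  \<comment> \<open>The half-line is not a compact interval, so the definition of the integral takes
    its unbounded branch.\<close>
  have "max 0 (b + 1) \<in> {0..}" "max 0 (b + 1) \<notin> cbox a b" for a b :: real by auto
  then have *: "\<not> (\<exists>a b. {0::real..} = cbox a b)" by metis
  show ?thesis
  proof (subst has_integral_alt[of h], subst if_not_P[OF *], intro allI impI)
    fix e :: real assume "0 < e"
    then obtain R where R: "\<And>x. R \<le> x \<Longrightarrow> \<bar>H x - L\<bar> < e"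
      using tendstoD[OF lim] by (auto simp: eventually_at_top_linorder dist_real_def)
    \<comment> \<open>A compact interval containing the ball of this radius reaches left to 0 and
      right beyond \<open>R\<close>.\<close>
    define B where "B = \<bar>R\<bar> + 1"
    show "\<exists>B>0. \<forall>a b. ball 0 B \<subseteq> cbox a b \<longrightarrow>
        (\<exists>z. ((\<lambda>x. if x \<in> {0..} then h x else 0) has_integral z) (cbox a b) \<and> norm (z - (L - H 0)) < e)"
    proof (rule exI[of _ B], intro conjI allI impI)
      show "0 < B" by (simp add: B_def)
      fix a b :: real assume sub: "ball 0 B \<subseteq> cbox a b"
      have "0 \<in> ball 0 B" "\<bar>R\<bar> \<in> ball 0 B" by (simp_all add: B_def)
      from this[THEN subsetD[OF sub]] have ab: "a \<le> 0" "\<bar>R\<bar> \<le> b" by simp_all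
      have "(h has_integral (H b - H 0)) {0..b}"
      proof (rule fundamental_theorem_of_calculus_interior)
        show "continuous_on {0..b} H" by (rule continuous_on_subset[OF cont]) simp
        show "(H has_vector_derivative h x) (at x)" if "x \<in> {0<..<b}" for x
          using deriv[of x] that by (simp add: has_real_derivative_iff_has_vector_derivative)
      qed (use ab in simp)
      moreover have "{0..} \<inter> cbox a b = {0..b}" using ab by auto
      ultimately have "((\<lambda>x. if x \<in> {0..} then h x else 0) has_integral (H b - H 0)) (cbox a b)"
        by (simp only: has_integral_restrict_Int)
      moreover have "norm ((H b - H 0) - (L - H 0)) < e" using R[of b] ab by simp
      ultimately show "\<exists>z. ((\<lambda>x. if x \<in> {0..} then h x else 0) has_integral z) (cbox a b) \<and> norm (z - (L - H 0)) < e"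
        by blast
    qed
  qed
qed

section \<open>The mean interference\<close>

lemma isCont_ksqrt:
  assumes "0 < s"
  shows "isCont (\<lambda>r. ksqrt s d (of_real r)) r"
  by (rule isCont_o2[where f = of_real and g = "ksqrt s d", OF _ DERIV_isCont[OF ksqrt_has_field_derivative[OF assms]]]) simp

lemma emeasure_isotropic_intensity_finite:
  assumes "0 < lam" and F: "\<And>r. 0 \<le> r \<Longrightarrow> 0 \<le> F r \<and> F r \<le> 1" and "continuous_on {0..} F"
    and B: "B \<in> sets borel" "bounded B"
  shows "emeasure (isotropic_intensity lam F) B < \<infinity>"
proof -
  have [measurable]: "(\<lambda>x::real^2. F (norm x)) \<in> borel_measurable borel"
    by (intro borel_measurable_continuous_onI continuous_on_compose2[OF assms(3)] continuous_intros) auto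
  have "emeasure (isotropic_intensity lam F) B = (\<integral>\<^sup>+x. ennreal (lam * F (norm x)) * indicator B x \<partial>lborel)"
    using B by (simp add: isotropic_intensity_def emeasure_density)
  also have "\<dots> \<le> (\<integral>\<^sup>+x. ennreal lam * indicator B x \<partial>lborel)"
    using F assms(1) by (intro nn_integral_mono mult_right_mono ennreal_leI) (auto simp: mult_left_le)
  also have "\<dots> = ennreal lam * emeasure lborel B" using B by (simp add: nn_integral_cmult)
  also have "\<dots> < \<infinity>"
    using emeasure_bounded_finite[OF B(2)] by (simp add: ennreal_mult_less_top)
  finally show ?thesis .
qed

theorem theorem3:
  fixes M :: "'w measure"
    and \<Phi> :: "'w \<Rightarrow> (real^2) set"
    and N :: "'w \<Rightarrow> enat"
    and X :: "nat \<Rightarrow> 'w \<Rightarrow> real^2"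
    and g :: "nat \<Rightarrow> 'w \<Rightarrow> real"
    and lam c :: real
    and F f :: "real \<Rightarrow> real"
    and y0 :: "real^2"
  assumes "0 < lam"
    and "\<And>r. 0 \<le> r \<Longrightarrow> 0 \<le> F r \<and> F r \<le> 1"
    and "continuous_on {0..} F"
    and "\<And>r. 0 < r \<Longrightarrow> (F has_real_derivative f r) (at r)"
    and "poisson_point_process M (isotropic_intensity lam F) \<Phi>"
    and "iid_fading M \<Phi> N X g"
    and "0 < c"
  shows "(\<integral>\<^sup>+\<omega>. interference c 4 N X g y0 \<omega> \<partial>M) < \<infinity> \<and>
         ((\<exists>F_inf. (F \<longlongrightarrow> F_inf) at_top) \<longrightarrow>
            enn2real (\<integral>\<^sup>+\<omega>. interference c 4 N X g y0 \<omega> \<partial>M) = lam * A4 F f y0 c)"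
proof -
  define s d where "s = sqrt c" and "d = norm y0"
  have s: "0 < s" and s2: "s\<^sup>2 = c" using assms(7) by (simp_all add: s_def)
  define G where "G r = Im (Ln (phase s d (of_real r)))" for r
  define D where "D r = 4 * r * Re (1 / ksqrt s d (of_real r))" for r
  have G': "(G has_real_derivative D r) (at r)" for r
    unfolding G_def[abs_def] D_def by (rule Im_Ln_phase_has_real_derivative[OF s])
  have D0: "0 \<le> D r" if "0 \<le> r" for r
    using Re_ksqrt_pos[OF s, of d r] that by (simp add: D_def Re_divide)
  have "isCont D r" for r
    unfolding D_def[abs_def] using Re_ksqrt_pos[OF s, of d r]
    by (intro continuous_mult continuous_const continuous_ident continuous_Re continuous_divide isCont_ksqrt[OF s]) auto
  then have [measurable]: "D \<in> borel_measurable borel"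
    by (intro borel_measurable_continuous_onI continuous_at_imp_continuous_on) auto
  obtain L where L: "(G \<longlongrightarrow> L) at_top"
    using Im_Ln_phase_convergent[OF s, of d] unfolding G_def[abs_def] by blast
  \<comment> \<open>Nothing is known about \<open>F\<close> on negative arguments; \<open>E\<close>
    agrees with \<open>F\<close> on the half-line and is bounded and measurable everywhere.\<close>
  define E where "E r = F (max 0 r)" for r
  have E: "0 \<le> E r" "E r \<le> 1" for r using assms(2)[of "max 0 r"] by (simp_all add: E_def)
  have EF: "E r = F r" if "0 \<le> r" for r using that by (simp add: E_def)
  have [measurable]: "E \<in> borel_measurable borel"
    unfolding E_def[abs_def]
    by (intro borel_measurable_continuous_onI continuous_on_compose2[OF assms(3)] continuous_intros) auto
  have \<Lambda>: "isotropic_intensity lam F = density lborel (\<lambda>x. ennreal (lam * E (norm x)))"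
    by (simp add: isotropic_intensity_def EF)
  define J where "J = (\<integral>\<^sup>+r. ennreal (E r * D r) * indicator {0..} r \<partial>lborel)"
  have "(\<integral>\<^sup>+\<omega>. interference c 4 N X g y0 \<omega> \<partial>M)
      = (\<integral>\<^sup>+x. ennreal (path_loss c 4 (norm (x - y0))) \<partial>isotropic_intensity lam F)"
    by (rule nn_integral_interference[OF assms(5) _ emeasure_isotropic_intensity_finite[OF assms(1-3)] assms(6,7)])
       (simp_all add: isotropic_intensity_def)
  also have "\<dots> = (\<integral>\<^sup>+x. ennreal (lam * E (norm x)) * ennreal (1 / (s\<^sup>2 + norm (x - y0) ^ 4)) \<partial>lborel)"
  proof -
    have "x powr 4 = x ^ 4" if "0 \<le> x" for x :: real
      using powr_numeral[OF that, of "num.Bit0 (num.Bit0 num.One)"] by simp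
    then have "path_loss c 4 (norm (x - y0)) = 1 / (s\<^sup>2 + norm (x - y0) ^ 4)" for x
      by (simp add: path_loss_def s2 divide_inverse)
    then show ?thesis unfolding \<Lambda> by (subst nn_integral_density) simp_all
  qed
  also have "\<dots> = (\<integral>\<^sup>+r. ennreal (lam * E r) * ennreal (2 * pi / s * (r * Re (1 / ksqrt s d (of_real r)))) * indicator {0..} r \<partial>lborel)"
    unfolding d_def by (rule nn_integral_planar[OF _ s]) measurable
  also have "\<dots> = (\<integral>\<^sup>+r. ennreal (lam * (pi / (2 * s))) * (ennreal (E r * D r) * indicator {0..} r) \<partial>lborel)"
  proof (rule nn_integral_cong)
    fix r :: real
    \<comment> \<open>The circle integral is \<open>pi / (2 * s)\<close> times the derivative
      \<open>D\<close> of \<open>G\<close>, which explains the prefactor in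
      \<open>A4\<close>.\<close>
    have "2 * pi / s * (r * Re (1 / ksqrt s d (of_real r))) = pi / (2 * s) * D r" by (simp add: D_def)
    moreover have "ennreal (lam * E r) * ennreal (pi / (2 * s) * D r) = ennreal (lam * (pi / (2 * s))) * ennreal (E r * D r)"
    proof -
      have "ennreal (lam * E r) * ennreal (pi / (2 * s) * D r) = ennreal (lam * E r * (pi / (2 * s) * D r))"
        using assms(1) E by (intro ennreal_mult'[symmetric]) simp
      also have "lam * E r * (pi / (2 * s) * D r) = lam * (pi / (2 * s)) * (E r * D r)" by simp
      also have "ennreal \<dots> = ennreal (lam * (pi / (2 * s))) * ennreal (E r * D r)"
        using assms(1) s by (intro ennreal_mult') simp
      finally show ?thesis .
    qed
    ultimately show "ennreal (lam * E r) * ennreal (2 * pi / s * (r * Re (1 / ksqrt s d (of_real r)))) * indicator {0..} r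
        = ennreal (lam * (pi / (2 * s))) * (ennreal (E r * D r) * indicator {0..} r)"
      by (simp only: mult.assoc)
  qed
  also have "\<dots> = ennreal (lam * (pi / (2 * s))) * J"
    unfolding J_def by (rule nn_integral_cmult) measurable
  finally have mean: "(\<integral>\<^sup>+\<omega>. interference c 4 N X g y0 \<omega> \<partial>M) = ennreal (lam * (pi / (2 * s))) * J" .
  \<comment> \<open>Since \<open>E <= 1\<close>, the radial integral is at most the total increase
    of \<open>G\<close>. Finiteness thus does not depend on convergence of \<open>F\<close> at
    infinity.\<close>
  have "J \<le> (\<integral>\<^sup>+r. ennreal (D r) * indicator {0..} r \<partial>lborel)"
    unfolding J_def using E D0
    by (intro nn_integral_mono) (auto intro!: ennreal_leI mult_left_le_one_le split: split_indicator)
  also have "\<dots> = ennreal (L - G 0)"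
    by (rule nn_integral_FTC_atLeast[OF _ G' D0 L]) measurable
  finally have J: "J < \<infinity>" by (metis ennreal_less_top infinity_ennreal_def order_le_less_trans)
  have "enn2real (ennreal (lam * (pi / (2 * s))) * J) = lam * A4 F f y0 c" if lim: "(F \<longlongrightarrow> K) at_top" for K
  proof -
    \<comment> \<open>The Lebesgue integral is turned into a gauge integral, the kind used in
      \<open>A4\<close>.\<close>
    have "((\<lambda>r. E r * D r * indicator {0..} r) has_integral enn2real J) UNIV"
    proof (rule nn_integral_has_integral)
      have "(\<integral>\<^sup>+r. ennreal (E r * D r * indicator {0..} r) \<partial>lborel) = J"
        unfolding J_def by (intro nn_integral_cong) (auto split: split_indicator)
      then show "(\<integral>\<^sup>+r. ennreal (E r * D r * indicator {0..} r) \<partial>lborel) = ennreal (enn2real J)"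
        using J by simp
    qed (use E D0 in \<open>auto split: split_indicator\<close>)
    then have "((\<lambda>r. if r \<in> {0..} then E r * D r else 0) has_integral enn2real J) UNIV"
      by (rule has_integral_eq[rotated]) simp
    then have "((\<lambda>r. E r * D r) has_integral enn2real J) {0..}"
      by (simp only: has_integral_restrict_UNIV)
    moreover have "((\<lambda>r. f r * G r + D r * F r) has_integral (K * L - F 0 * G 0)) {0..}"
    proof (rule has_integral_atLeast_FTC)
      show "continuous_on {0..} (\<lambda>r. F r * G r)"
        by (intro continuous_on_mult assms(3) continuous_at_imp_continuous_on ballI DERIV_isCont[OF G'])
      show "((\<lambda>r. F r * G r) has_real_derivative f r * G r + D r * F r) (at r)" if "0 < r" for r
        by (intro DERIV_mult assms(4) G' that)
      show "((\<lambda>r. F r * G r) \<longlongrightarrow> K * L) at_top" by (intro tendsto_mult lim L)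
    qed
    \<comment> \<open>Subtracting the known integral of \<open>E * D\<close> from that of the
      derivative of \<open>F * G\<close> isolates \<open>f * G\<close>, whose integrability is a
      result here and not a hypothesis.\<close>
    ultimately have "((\<lambda>r. f r * G r + D r * F r - E r * D r) has_integral (K * L - F 0 * G 0 - enn2real J)) {0..}"
      by (intro has_integral_diff)
    \<comment> \<open>The arctangent term is identified with \<open>G\<close> only for
      \<open>r > 0\<close>; the single point 0 does not affect the integral.\<close>
    then have "((\<lambda>r. f r * arctan_term r c y0) has_integral (K * L - F 0 * G 0 - enn2real J)) {0..}"
      by (rule has_integral_spike_finite[of "{0}", rotated 2])
         (auto simp: EF arctan_term_eq[OF assms(7)] G_def s_def d_def)
    then have int: "integral {0..} (\<lambda>r. f r * arctan_term r c y0) = K * L - F 0 * G 0 - enn2real J"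
      by (rule integral_unique)
    have eq: "F r * G r = F r * arctan_term r c y0" if "0 < r" for r
      using that by (simp add: arctan_term_eq[OF assms(7)] G_def s_def d_def)
    have "((\<lambda>r. F r * arctan_term r c y0) \<longlongrightarrow> K * L) at_top"
      by (rule Lim_transform_eventually[OF tendsto_mult[OF lim L]])
         (intro eventually_at_top_linorderI[of 1] eq, simp)
    then have top: "Lim at_top (\<lambda>r. F r * arctan_term r c y0) = K * L"
      by (intro tendsto_Lim) auto
    \<comment> \<open>The lower boundary term is a one-sided limit, found from the continuity of
      \<open>F\<close> and \<open>G\<close> at 0 and not from the arctangent quotient there.\<close>
    have "(F \<longlongrightarrow> F 0) (at_right 0)"
      using assms(3) by (auto simp: continuous_on_def intro: tendsto_within_subset)
    moreover have "(G \<longlongrightarrow> G 0) (at_right 0)"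
      using DERIV_isCont[OF G', of 0] by (auto simp: isCont_def intro: filterlim_mono at_le)
    ultimately have "((\<lambda>r. F r * G r) \<longlongrightarrow> F 0 * G 0) (at_right 0)" by (rule tendsto_mult)
    then have "((\<lambda>r. F r * arctan_term r c y0) \<longlongrightarrow> F 0 * G 0) (at_right 0)"
      by (rule Lim_transform_eventually) (use eq in \<open>auto simp: eventually_at_filter\<close>)
    then have zero: "Lim (at_right 0) (\<lambda>r. F r * arctan_term r c y0) = F 0 * G 0"
      by (intro tendsto_Lim) auto
    have "A4 F f y0 c = pi / (2 * s) * enn2real J"
      unfolding A4_def top zero int by (simp add: s_def)
    then show ?thesis using assms(1) s by (simp add: enn2real_mult)
  qed
  moreover have "ennreal (lam * (pi / (2 * s))) * J < \<infinity>"
    using J by (simp add: ennreal_mult_less_top)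
  ultimately show ?thesis unfolding mean by blast
qed

end
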